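(* Let $(\mathcal{L},\alpha)=(A,L,[-,-],\phi,\alpha,\rho)$ be a hom-Lie-Rinehart algebra over $(A,\phi)$, with $\phi$ an algebra automorphism of $A$, and let $(M,\beta)$ be a left module over $(\mathcal{L},\alpha)$. There is a one-to-one correspondence between the equivalence classes of $A$-split abelian extensions of $(\mathcal{L},\alpha)$ by $(M,\beta)$ and the cohomology classes in $H^2_{hLR}(L,M)$.
   Context: $R$ is a commutative ring with unity; all modules, algebras, tensor products and linear maps are over $R$ unless stated otherwise. $A$ is an associative commutative $R$-algebra, and $A$-module actions are assumed faithful throughout. A hat denotes omission; $\wedge^n_R$ is the exterior power over $R$. A hom-Lie algebra $(\mathfrak{g},[-,-],\alpha)$ is an $R$-module with a skew-symmetric $R$-bilinear bracket and a linear map $\alpha$ with $\alpha[x,y]=[\alpha(x),\alpha(y)]$ and $[\alpha(x),[y,z]]+[\alpha(y),[z,x]]+[\alpha(z),[x,y]]=0$. A representation of it on an $R$-module $V$ is a pair $(\theta,\beta)$ of linear maps $\theta:\mathfrak{g}\to\mathrm{End}_R(V)$, $\beta:V\to V$ with $\theta(\alpha(x))\circ\beta=\beta\circ\theta(x)$ and $\theta([x,y])\circ\beta=\theta(\alpha(x))\circ\theta(y)-\theta(\alpha(y))\circ\theta(x)$. $Der_\phi(A)$ is the $A$-module of $R$-linear maps $\delta:A\to A$ with $\delta(ab)=\phi(a)\delta(b)+\phi(b)\delta(a)$. A hom-Lie-Rinehart algebra over $(A,\phi)$ is a tuple $(A,L,[-,-],\phi,\alpha,\rho)$, written $(\mathcal{L},\alpha)$,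 with $L$ an $A$-module, $[-,-]:L\times L\to L$ skew-symmetric $R$-bilinear, $\alpha:L\to L$ linear with $\alpha[x,y]=[\alpha(x),\alpha(y)]$, and $\rho:L\to Der_\phi(A)$ $R$-linear (the anchor), such that for all $a\in A$, $x,y\in L$: (1) $(L,[-,-],\alpha)$ is a hom-Lie algebra; (2) $\alpha(a.x)=\phi(a).\alpha(x)$; (3) $(\rho,\phi)$ is a representation of $(L,[-,-],\alpha)$ on $A$; (4) $\rho(a.x)=\phi(a).\rho(x)$; (5) $[x,a.y]=\phi(a)[x,y]+\rho(x)(a)\alpha(y)$. The category $hLR_A^\phi$ has these as objects; a morphism $(\mathcal{L},\alpha)\to(\mathcal{L}',\alpha')$ is an $A$-linear map $f:L\to L'$ with $f[x,y]=[f(x),f(y)]'$, $f\circ\alpha=\alpha'\circ f$ and $\rho'\circ f=\rho$. A left module over $(\mathcal{L},\alpha)$ is a pair $(M,\beta)$ with $M$ an $A$-module, $\beta\in End_R(M)$, and a map $\theta:L\otimes M\to M$, $\theta(x,m)=\{x,m\}$, such that (1) $(\theta,\beta)$ is a representation of $(L,[-,-],\alpha)$ on $M$; (2) $\beta(a.m)=\phi(a).\beta(m)$; (3) $\{a.x,m\}=\phi(a)\{x,m\}$; (4) $\{x,a.m\}=\phi(a)\{x,m\}+\rho(x)(a).\beta(m)$. Such $(M,\beta)$ gives a hom-Lie-Rinehart algebra $(\mathcal{M},\beta)$ over $(A,\phi)$ with zero bracket and zero anchor. Cohomology: for $n\ge1$, $C^n(L;M)\subseteq Hom_R(\wedge^n_RL,M)$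 consists of $f$ with $f(\alpha(x_1),\dots,\alpha(x_n))=\beta(f(x_1,\dots,x_n))$ and $f(x_1,\dots,a.x_i,\dots,x_n)=\phi^{n-1}(a)f(x_1,\dots,x_i,\dots,x_n)$. The coboundary $\delta:C^n(L;M)\to C^{n+1}(L;M)$ is $$\delta f(x_1,\dots,x_{n+1})=\sum_{i=1}^{n+1}(-1)^{i+1}\{\alpha^{n-1}(x_i),f(x_1,\dots,\hat{x_i},\dots,x_{n+1})\}+\sum_{1\le i<j\le n+1}(-1)^{i+j}f([x_i,x_j],\alpha(x_1),\dots,\widehat{\alpha(x_i)},\dots,\widehat{\alpha(x_j)},\dots,\alpha(x_{n+1})),$$ and $\delta^2=0$. $H^*_{hLR}(L,M)$ is the cohomology of the complex $(\bigoplus_{n\ge1}C^n(L;M),\delta)$. Extensions: a short exact sequence $(\mathcal{L}'',\alpha'')\xrightarrow{i}(\mathcal{L}',\alpha')\xrightarrow{\sigma}(\mathcal{L},\alpha)$ in $hLR_A^\phi$ means that the homomorphism $i$ is injective, the homomorphism $\sigma$ is surjective, and $\sigma\circ i=0$ (the anchor of $(\mathcal{L}'',\alpha'')$ is then zero). It is called an extension of $(\mathcal{L},\alpha)$ by $(\mathcal{L}'',\alpha'')$. It is $A$-split if there is an $A$-linear map $\tau:L\to L'$ with $\sigma\circ\tau=Id_L$ and $\tau\circ\alpha=\alpha'\circ\tau$. An abelian extension of $(\mathcal{L},\alpha)$ by the module $(M,\beta)$ is a short exact sequence $(\mathcal{M},\beta)\xrightarrow{i}(\mathcal{L}',\alpha')\xrightarrow{\sigma}(\mathcal{L},\alpha)$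 in $hLR_A^\phi$ with $[x,i(m)]'=i(\{\sigma(x),m\})$ for all $m\in M$, $x\in L'$. Two such extensions, with middle terms $(\mathcal{L}',\alpha')$, $(\mathcal{L}'',\alpha'')$ and maps $(i,\sigma)$, $(i',\sigma')$, are equivalent if there is an isomorphism $\Phi:(\mathcal{L}',\alpha')\to(\mathcal{L}'',\alpha'')$ in $hLR_A^\phi$ with $\Phi\circ i=i'$ and $\sigma'\circ\Phi=\sigma$.
   Formalization: Short exact sequences are required to satisfy im i = ker σ, not only σ∘i = 0 (with the latter alone the claim fails: add any summand with zero bracket to the middle term), and skew-symmetric brackets are taken to satisfy [x,x] = 0. *)

theory Defs
  imports "HOL-Algebra.Module" "HOL-Library.FuncSet"
begin

section \<open>Linear maps and restriction of scalars\<close>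

text \<open>
  An \<open>A\<close>-module over an \<open>R\<close>-algebra \<open>A\<close> is an \<open>R\<close>-module through \<open>r \<mapsto> r \<cdot> 1\<^sub>A\<close>.  In records that
  represent modules the inherited fields \<open>mult\<close> and \<open>one\<close> carry no information.
\<close>

definition restrict_scalars ::
  "('r, 'a, 'c) module_scheme \<Rightarrow> ('a, 'm, 'd) module_scheme \<Rightarrow> ('r, 'm) module" where
  "restrict_scalars A M =
     \<lparr>carrier = carrier M, monoid.mult = monoid.mult M, one = one M,
      zero = zero M, add = add M, smult = (\<lambda>r m. (r \<odot>\<^bsub>A\<^esub> \<one>\<^bsub>A\<^esub>) \<odot>\<^bsub>M\<^esub> m)\<rparr>"

definition linear_map ::
  "('r, 'c) ring_scheme \<Rightarrow> ('r, 'v, 'd) module_scheme \<Rightarrow> ('r, 'w, 'e) module_scheme \<Rightarrow> ('v \<Rightarrow> 'w) \<Rightarrow> bool" where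
  "linear_map R V W f \<longleftrightarrow>
     f \<in> carrier V \<rightarrow> carrier W \<and>
     (\<forall>x\<in>carrier V. \<forall>y\<in>carrier V. f (x \<oplus>\<^bsub>V\<^esub> y) = f x \<oplus>\<^bsub>W\<^esub> f y) \<and>
     (\<forall>r\<in>carrier R. \<forall>x\<in>carrier V. f (r \<odot>\<^bsub>V\<^esub> x) = r \<odot>\<^bsub>W\<^esub> f x)"

definition bilinear_map ::
  "('r, 'c) ring_scheme \<Rightarrow> ('r, 'u, 'd) module_scheme \<Rightarrow> ('r, 'v, 'e) module_scheme \<Rightarrow>
   ('r, 'w, 'f) module_scheme \<Rightarrow> ('u \<Rightarrow> 'v \<Rightarrow> 'w) \<Rightarrow> bool" where
  "bilinear_map R U V W f \<longleftrightarrow>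
     (\<forall>u\<in>carrier U. linear_map R V W (f u)) \<and>
     (\<forall>v\<in>carrier V. linear_map R U W (\<lambda>u. f u v))"

definition faithful_module ::
  "('a, 'c) ring_scheme \<Rightarrow> ('a, 'm, 'd) module_scheme \<Rightarrow> bool" where
  "faithful_module A M \<longleftrightarrow>
     module A M \<and> (\<forall>a\<in>carrier A. (\<forall>m\<in>carrier M. a \<odot>\<^bsub>M\<^esub> m = \<zero>\<^bsub>M\<^esub>) \<longrightarrow> a = \<zero>\<^bsub>A\<^esub>)"

definition algebra_endomorphism ::
  "('r, 'c) ring_scheme \<Rightarrow> ('r, 'a, 'd) module_scheme \<Rightarrow> ('a \<Rightarrow> 'a) \<Rightarrow> bool" where
  "algebra_endomorphism R A \<phi> \<longleftrightarrow> \<phi> \<in> ring_hom A A \<and> linear_map R A A \<phi>"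

definition algebra_automorphism ::
  "('r, 'c) ring_scheme \<Rightarrow> ('r, 'a, 'd) module_scheme \<Rightarrow> ('a \<Rightarrow> 'a) \<Rightarrow> bool" where
  "algebra_automorphism R A \<phi> \<longleftrightarrow>
     algebra_endomorphism R A \<phi> \<and> bij_betw \<phi> (carrier A) (carrier A)"


section \<open>Hom-Lie algebras and their representations\<close>

text \<open>
  Skew-symmetry is taken in the sense \<open>[x, x] = 0\<close>, i.e. the bracket factors through the exterior
  square of \<open>V\<close>; with bilinearity this gives \<open>[x, y] = - [y, x]\<close>, and the two are equivalent when
  2 is invertible in \<open>R\<close>.
\<close>

definition hom_Lie_algebra ::
  "('r, 'c) ring_scheme \<Rightarrow> ('r, 'v, 'd) module_scheme \<Rightarrow> ('v \<Rightarrow> 'v \<Rightarrow> 'v) \<Rightarrow> ('v \<Rightarrow> 'v) \<Rightarrow> bool" where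
  "hom_Lie_algebra R V br \<alpha> \<longleftrightarrow>
     module R V \<and> bilinear_map R V V V br \<and> linear_map R V V \<alpha> \<and>
     (\<forall>x\<in>carrier V. br x x = \<zero>\<^bsub>V\<^esub>) \<and>
     (\<forall>x\<in>carrier V. \<forall>y\<in>carrier V. \<alpha> (br x y) = br (\<alpha> x) (\<alpha> y)) \<and>
     (\<forall>x\<in>carrier V. \<forall>y\<in>carrier V. \<forall>z\<in>carrier V.
        br (\<alpha> x) (br y z) \<oplus>\<^bsub>V\<^esub> br (\<alpha> y) (br z x) \<oplus>\<^bsub>V\<^esub> br (\<alpha> z) (br x y) = \<zero>\<^bsub>V\<^esub>)"

definition hom_Lie_representation ::
  "('r, 'c) ring_scheme \<Rightarrow> ('r, 'v, 'd) module_scheme \<Rightarrow> ('v \<Rightarrow> 'v \<Rightarrow> 'v) \<Rightarrow> ('v \<Rightarrow> 'v) \<Rightarrow>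
   ('r, 'w, 'e) module_scheme \<Rightarrow> ('v \<Rightarrow> 'w \<Rightarrow> 'w) \<Rightarrow> ('w \<Rightarrow> 'w) \<Rightarrow> bool" where
  "hom_Lie_representation R V br \<alpha> W \<theta> \<beta> \<longleftrightarrow>
     module R W \<and> bilinear_map R V W W \<theta> \<and> linear_map R W W \<beta> \<and>
     (\<forall>x\<in>carrier V. \<forall>w\<in>carrier W. \<theta> (\<alpha> x) (\<beta> w) = \<beta> (\<theta> x w)) \<and>
     (\<forall>x\<in>carrier V. \<forall>y\<in>carrier V. \<forall>w\<in>carrier W.
        \<theta> (br x y) (\<beta> w) = \<theta> (\<alpha> x) (\<theta> y w) \<ominus>\<^bsub>W\<^esub> \<theta> (\<alpha> y) (\<theta> x w))"


section \<open>Hom-Lie-Rinehart algebras and their modules\<close>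

definition phi_derivations ::
  "('r, 'c) ring_scheme \<Rightarrow> ('r, 'a, 'd) module_scheme \<Rightarrow> ('a \<Rightarrow> 'a) \<Rightarrow> ('a \<Rightarrow> 'a) set" where
  "phi_derivations R A \<phi> =
     {D. linear_map R A A D \<and>
         (\<forall>a\<in>carrier A. \<forall>b\<in>carrier A.
            D (a \<otimes>\<^bsub>A\<^esub> b) = \<phi> a \<otimes>\<^bsub>A\<^esub> D b \<oplus>\<^bsub>A\<^esub> \<phi> b \<otimes>\<^bsub>A\<^esub> D a)}"

record ('a, 'l) hlr = "('a, 'l) module" +
  bracket :: "'l \<Rightarrow> 'l \<Rightarrow> 'l"
  twist :: "'l \<Rightarrow> 'l"
  anchor :: "'l \<Rightarrow> 'a \<Rightarrow> 'a"

definition hom_Lie_Rinehart ::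
  "('r, 'c) ring_scheme \<Rightarrow> ('r, 'a, 'd) module_scheme \<Rightarrow> ('a \<Rightarrow> 'a) \<Rightarrow> ('a, 'l) hlr \<Rightarrow> bool" where
  "hom_Lie_Rinehart R A \<phi> L \<longleftrightarrow>
     algebra R A \<and> algebra_endomorphism R A \<phi> \<and> faithful_module A L \<and>
     (\<forall>x\<in>carrier L. anchor L x \<in> phi_derivations R A \<phi>) \<and>
     hom_Lie_algebra R (restrict_scalars A L) (bracket L) (twist L) \<and>
     (\<forall>a\<in>carrier A. \<forall>x\<in>carrier L. twist L (a \<odot>\<^bsub>L\<^esub> x) = \<phi> a \<odot>\<^bsub>L\<^esub> twist L x) \<and>
     hom_Lie_representation R (restrict_scalars A L) (bracket L) (twist L) A (anchor L) \<phi> \<and>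
     (\<forall>a\<in>carrier A. \<forall>x\<in>carrier L. \<forall>b\<in>carrier A.
        anchor L (a \<odot>\<^bsub>L\<^esub> x) b = \<phi> a \<otimes>\<^bsub>A\<^esub> anchor L x b) \<and>
     (\<forall>x\<in>carrier L. \<forall>a\<in>carrier A. \<forall>y\<in>carrier L.
        bracket L x (a \<odot>\<^bsub>L\<^esub> y) =
          \<phi> a \<odot>\<^bsub>L\<^esub> bracket L x y \<oplus>\<^bsub>L\<^esub> anchor L x a \<odot>\<^bsub>L\<^esub> twist L y)"

definition hlr_hom ::
  "('a, 'c) ring_scheme \<Rightarrow> ('a, 'l) hlr \<Rightarrow> ('a, 'k) hlr \<Rightarrow> ('l \<Rightarrow> 'k) \<Rightarrow> bool" where
  "hlr_hom A L K f \<longleftrightarrow>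
     linear_map A L K f \<and>
     (\<forall>x\<in>carrier L. \<forall>y\<in>carrier L. f (bracket L x y) = bracket K (f x) (f y)) \<and>
     (\<forall>x\<in>carrier L. f (twist L x) = twist K (f x)) \<and>
     (\<forall>x\<in>carrier L. \<forall>a\<in>carrier A. anchor K (f x) a = anchor L x a)"

definition hlr_iso ::
  "('a, 'c) ring_scheme \<Rightarrow> ('a, 'l) hlr \<Rightarrow> ('a, 'k) hlr \<Rightarrow> ('l \<Rightarrow> 'k) \<Rightarrow> bool" where
  "hlr_iso A L K f \<longleftrightarrow>
     hlr_hom A L K f \<and>
     (\<exists>g. hlr_hom A K L g \<and> (\<forall>x\<in>carrier L. g (f x) = x) \<and> (\<forall>y\<in>carrier K. f (g y) = y))"

text \<open>A left module \<open>(M, \<beta>)\<close> with action \<open>{x, m}\<close>, written \<open>action M x m\<close>.\<close>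

record ('a, 'l, 'm) hlr_module = "('a, 'm) module" +
  endo :: "'m \<Rightarrow> 'm"
  action :: "'l \<Rightarrow> 'm \<Rightarrow> 'm"

definition left_module ::
  "('r, 'c) ring_scheme \<Rightarrow> ('r, 'a, 'd) module_scheme \<Rightarrow> ('a \<Rightarrow> 'a) \<Rightarrow>
   ('a, 'l) hlr \<Rightarrow> ('a, 'l, 'm) hlr_module \<Rightarrow> bool" where
  "left_module R A \<phi> L M \<longleftrightarrow>
     faithful_module A M \<and>
     hom_Lie_representation R (restrict_scalars A L) (bracket L) (twist L)
       (restrict_scalars A M) (action M) (endo M) \<and>
     (\<forall>a\<in>carrier A. \<forall>m\<in>carrier M. endo M (a \<odot>\<^bsub>M\<^esub> m) = \<phi> a \<odot>\<^bsub>M\<^esub> endo M m) \<and>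
     (\<forall>a\<in>carrier A. \<forall>x\<in>carrier L. \<forall>m\<in>carrier M.
        action M (a \<odot>\<^bsub>L\<^esub> x) m = \<phi> a \<odot>\<^bsub>M\<^esub> action M x m) \<and>
     (\<forall>x\<in>carrier L. \<forall>a\<in>carrier A. \<forall>m\<in>carrier M.
        action M x (a \<odot>\<^bsub>M\<^esub> m) =
          \<phi> a \<odot>\<^bsub>M\<^esub> action M x m \<oplus>\<^bsub>M\<^esub> anchor L x a \<odot>\<^bsub>M\<^esub> endo M m)"

definition trivial_hlr ::
  "('a, 'c) ring_scheme \<Rightarrow> ('a, 'l, 'm) hlr_module \<Rightarrow> ('a, 'm) hlr" where
  "trivial_hlr A M =
     \<lparr>carrier = carrier M, monoid.mult = monoid.mult M, one = one M,
      zero = zero M, add = add M, smult = smult M,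
      bracket = (\<lambda>m n. \<zero>\<^bsub>M\<^esub>), twist = endo M, anchor = (\<lambda>m a. \<zero>\<^bsub>A\<^esub>)\<rparr>"


section \<open>Cohomology\<close>

text \<open>
  \<open>Hom(\<Lambda>\<^sup>n V, W)\<close> is rendered, by the universal property of the exterior power, as the set of
  alternating \<open>n\<close>-linear maps, i.e. functions on lists of length \<open>n\<close>.  They are \<open>undefined\<close> on other
  lists, so that equality of cochains is equality of functions.
\<close>

definition tuples :: "('v, 'c) partial_object_scheme \<Rightarrow> nat \<Rightarrow> 'v list set" where
  "tuples V n = {xs. length xs = n \<and> set xs \<subseteq> carrier V}"

definition alternating_maps ::
  "('r, 'c) ring_scheme \<Rightarrow> ('r, 'v, 'd) module_scheme \<Rightarrow> ('r, 'w, 'e) module_scheme \<Rightarrow>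
   nat \<Rightarrow> ('v list \<Rightarrow> 'w) set" where
  "alternating_maps R V W n =
     {f \<in> tuples V n \<rightarrow>\<^sub>E carrier W.
        (\<forall>xs\<in>tuples V n. \<forall>i<n. linear_map R V W (\<lambda>x. f (xs[i := x]))) \<and>
        (\<forall>xs\<in>tuples V n. \<forall>i<n. \<forall>j<n. i \<noteq> j \<and> xs ! i = xs ! j \<longrightarrow> f xs = \<zero>\<^bsub>W\<^esub>)}"

definition cochains ::
  "('r, 'c) ring_scheme \<Rightarrow> ('r, 'a, 'd) module_scheme \<Rightarrow> ('a \<Rightarrow> 'a) \<Rightarrow>
   ('a, 'l) hlr \<Rightarrow> ('a, 'l, 'm) hlr_module \<Rightarrow> nat \<Rightarrow> ('l list \<Rightarrow> 'm) set" where
  "cochains R A \<phi> L M n =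
     {f \<in> alternating_maps R (restrict_scalars A L) (restrict_scalars A M) n.
        (\<forall>xs\<in>tuples L n. f (map (twist L) xs) = endo M (f xs)) \<and>
        (\<forall>xs\<in>tuples L n. \<forall>i<n. \<forall>a\<in>carrier A.
           f (xs[i := a \<odot>\<^bsub>L\<^esub> xs ! i]) = (\<phi> ^^ (n - 1)) a \<odot>\<^bsub>M\<^esub> f xs)}"

text \<open>
  Indices run over \<open>0, \<dots>, n\<close> instead of \<open>1, \<dots>, n + 1\<close>, hence the sign \<open>(-1)\<^sup>i\<close> in the first sum.
  Omission of entries is expressed by \<open>nths\<close>.
\<close>

definition coboundary ::
  "('a, 'l) hlr \<Rightarrow> ('a, 'l, 'm) hlr_module \<Rightarrow> nat \<Rightarrow> ('l list \<Rightarrow> 'm) \<Rightarrow> 'l list \<Rightarrow> 'm" where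
  "coboundary L M n f = (\<lambda>xs\<in>tuples L (n + 1).
     (\<Oplus>\<^bsub>M\<^esub>i\<in>{..n}. [((-1::int) ^ i)] \<cdot>\<^bsub>M\<^esub>
        action M ((twist L ^^ (n - 1)) (xs ! i)) (f (nths xs (- {i}))))
     \<oplus>\<^bsub>M\<^esub>
     (\<Oplus>\<^bsub>M\<^esub>j\<in>{..n}. \<Oplus>\<^bsub>M\<^esub>i\<in>{..<j}. [((-1::int) ^ (i + j))] \<cdot>\<^bsub>M\<^esub>
        f (bracket L (xs ! i) (xs ! j) # map (twist L) (nths xs (- {i, j})))))"

definition zero_cochain ::
  "('a, 'l) hlr \<Rightarrow> ('a, 'l, 'm) hlr_module \<Rightarrow> nat \<Rightarrow> 'l list \<Rightarrow> 'm" where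
  "zero_cochain L M n = (\<lambda>xs\<in>tuples L n. \<zero>\<^bsub>M\<^esub>)"

definition cocycles ::
  "('r, 'c) ring_scheme \<Rightarrow> ('r, 'a, 'd) module_scheme \<Rightarrow> ('a \<Rightarrow> 'a) \<Rightarrow>
   ('a, 'l) hlr \<Rightarrow> ('a, 'l, 'm) hlr_module \<Rightarrow> nat \<Rightarrow> ('l list \<Rightarrow> 'm) set" where
  "cocycles R A \<phi> L M n =
     {f \<in> cochains R A \<phi> L M n. coboundary L M n f = zero_cochain L M (n + 1)}"

text \<open>The complex starts in degree 1.\<close>

definition coboundaries ::
  "('r, 'c) ring_scheme \<Rightarrow> ('r, 'a, 'd) module_scheme \<Rightarrow> ('a \<Rightarrow> 'a) \<Rightarrow>
   ('a, 'l) hlr \<Rightarrow> ('a, 'l, 'm) hlr_module \<Rightarrow> nat \<Rightarrow> ('l list \<Rightarrow> 'm) set" where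
  "coboundaries R A \<phi> L M n =
     (if n \<le> 1 then {zero_cochain L M n}
      else coboundary L M (n - 1) ` cochains R A \<phi> L M (n - 1))"

definition cohomology ::
  "('r, 'c) ring_scheme \<Rightarrow> ('r, 'a, 'd) module_scheme \<Rightarrow> ('a \<Rightarrow> 'a) \<Rightarrow>
   ('a, 'l) hlr \<Rightarrow> ('a, 'l, 'm) hlr_module \<Rightarrow> nat \<Rightarrow> ('l list \<Rightarrow> 'm) set set" where
  "cohomology R A \<phi> L M n =
     cocycles R A \<phi> L M n //
       {(f, g). f \<in> cocycles R A \<phi> L M n \<and> g \<in> cocycles R A \<phi> L M n \<and>
          (\<lambda>xs\<in>tuples L n. f xs \<ominus>\<^bsub>M\<^esub> g xs) \<in> coboundaries R A \<phi> L M n}"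


section \<open>Extensions\<close>

text \<open>
  Exactness in the middle, \<open>im i = ker \<sigma>\<close>, is part of the definition; it contains \<open>\<sigma> \<circ> i = 0\<close>.
\<close>

definition short_exact ::
  "('r, 'c) ring_scheme \<Rightarrow> ('r, 'a, 'd) module_scheme \<Rightarrow> ('a \<Rightarrow> 'a) \<Rightarrow>
   ('a, 'k) hlr \<Rightarrow> ('k \<Rightarrow> 'e) \<Rightarrow> ('a, 'e) hlr \<Rightarrow> ('e \<Rightarrow> 'l) \<Rightarrow> ('a, 'l) hlr \<Rightarrow> bool" where
  "short_exact R A \<phi> K i E \<sigma> L \<longleftrightarrow>
     hom_Lie_Rinehart R A \<phi> K \<and> hom_Lie_Rinehart R A \<phi> E \<and> hom_Lie_Rinehart R A \<phi> L \<and>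
     hlr_hom A K E i \<and> hlr_hom A E L \<sigma> \<and>
     inj_on i (carrier K) \<and> \<sigma> ` carrier E = carrier L \<and>
     i ` carrier K = {x \<in> carrier E. \<sigma> x = \<zero>\<^bsub>L\<^esub>}"

definition A_split ::
  "('a, 'c) ring_scheme \<Rightarrow> ('a, 'e) hlr \<Rightarrow> ('e \<Rightarrow> 'l) \<Rightarrow> ('a, 'l) hlr \<Rightarrow> bool" where
  "A_split A E \<sigma> L \<longleftrightarrow>
     (\<exists>\<tau>. linear_map A L E \<tau> \<and> (\<forall>x\<in>carrier L. \<sigma> (\<tau> x) = x) \<and>
          (\<forall>x\<in>carrier L. \<tau> (twist L x) = twist E (\<tau> x)))"

definition abelian_extension ::
  "('r, 'c) ring_scheme \<Rightarrow> ('r, 'a, 'd) module_scheme \<Rightarrow> ('a \<Rightarrow> 'a) \<Rightarrow>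
   ('a, 'l) hlr \<Rightarrow> ('a, 'l, 'm) hlr_module \<Rightarrow>
   ('a, 'e) hlr \<times> ('m \<Rightarrow> 'e) \<times> ('e \<Rightarrow> 'l) \<Rightarrow> bool" where
  "abelian_extension R A \<phi> L M = (\<lambda>(E, i, \<sigma>).
     short_exact R A \<phi> (trivial_hlr A M) i E \<sigma> L \<and>
     (\<forall>x\<in>carrier E. \<forall>m\<in>carrier M. bracket E x (i m) = i (action M (\<sigma> x) m)))"

definition equivalent_extensions ::
  "('a, 'c) ring_scheme \<Rightarrow> ('a, 'l, 'm) hlr_module \<Rightarrow>
   ('a, 'e) hlr \<times> ('m \<Rightarrow> 'e) \<times> ('e \<Rightarrow> 'l) \<Rightarrow>
   ('a, 'f) hlr \<times> ('m \<Rightarrow> 'f) \<times> ('f \<Rightarrow> 'l) \<Rightarrow> bool" where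
  "equivalent_extensions A M = (\<lambda>(E, i, \<sigma>) (E', i', \<sigma>').
     \<exists>\<Phi>. hlr_iso A E E' \<Phi> \<and>
         (\<forall>m\<in>carrier M. \<Phi> (i m) = i' m) \<and> (\<forall>x\<in>carrier E. \<sigma>' (\<Phi> x) = \<sigma> x))"

text \<open>
  The middle terms are those whose underlying set consists of elements of the type \<open>'e\<close>.  An
  \<open>A\<close>-split extension has an underlying set in bijection with \<open>L \<times> M\<close>, so every such extension,
  over any type, is equivalent to one in \<open>'e\<close> as soon as \<open>L \<times> M\<close> embeds into \<open>'e\<close>.
\<close>

definition split_abelian_extensions ::
  "('r, 'c) ring_scheme \<Rightarrow> ('r, 'a, 'd) module_scheme \<Rightarrow> ('a \<Rightarrow> 'a) \<Rightarrow>
   ('a, 'l) hlr \<Rightarrow> ('a, 'l, 'm) hlr_module \<Rightarrow>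
   (('a, 'e) hlr \<times> ('m \<Rightarrow> 'e) \<times> ('e \<Rightarrow> 'l)) set" where
  "split_abelian_extensions R A \<phi> L M =
     {(E, i, \<sigma>). abelian_extension R A \<phi> L M (E, i, \<sigma>) \<and> A_split A E \<sigma> L}"

definition extension_classes ::
  "('r, 'c) ring_scheme \<Rightarrow> ('r, 'a, 'd) module_scheme \<Rightarrow> ('a \<Rightarrow> 'a) \<Rightarrow>
   ('a, 'l) hlr \<Rightarrow> ('a, 'l, 'm) hlr_module \<Rightarrow>
   (('a, 'e) hlr \<times> ('m \<Rightarrow> 'e) \<times> ('e \<Rightarrow> 'l)) set set" where
  "extension_classes R A \<phi> L M =
     split_abelian_extensions R A \<phi> L M //
       {(X, Y). X \<in> split_abelian_extensions R A \<phi> L M \<and>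
          Y \<in> split_abelian_extensions R A \<phi> L M \<and> equivalent_extensions A M X Y}"

end

theory Submission
  imports Defs
begin

text \<open>
  A splitting \<open>\<tau>\<close> of an extension \<open>E\<close> is multiplicative up to \<open>c(x, y) = [\<tau> x, \<tau> y] - \<tau> [x, y]\<close>, which
  lies in \<open>M\<close>; there the Jacobi identity in \<open>E\<close> is the cocycle identity for \<open>c\<close>.  Conversely, a
  2-cocycle \<open>c\<close> twists the bracket of the semidirect product on \<open>L \<times> M\<close> into
  \<open>[(x, m), (y, n)] = ([x, y], {x, n} - {y, m} + c(x, y))\<close>, and \<open>(x, m) \<mapsto> \<tau> x + i m\<close> is an equivalence
  of this model with \<open>E\<close>.  An equivalence of the models of \<open>c\<close> and \<open>d\<close> has the form
  \<open>(x, m) \<mapsto> (x, h x + m)\<close>, and this map is compatible with the brackets iff \<open>c - d = \<delta> h\<close>.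
\<close>

text \<open>The identities for c are checked inside E, after applying the injective map i. Modulo
  A-linearity of c everything there is formal; the anchor is the obstacle, since neither bracket is
  A-bilinear. The anchor of E factors through \<sigma> and \<tau> commutes with the twists, so
  [\<tau> x, a.\<tau> y] and \<tau> [x, a.y] contain the same anchor term. It cancels in c, which is
  left \<phi>-linear in each argument, and this is what the exponent n - 1 demands of cochains in
  degree 2.

  No inverse of an equivalence has to be constructed: by the short five lemma, a morphism of
  extensions that is the identity on M and on L is bijective.

  No splitting is fixed for an extension either. An extension is related to every cocycle whose
  model is equivalent to it, and this relation descends to a bijection of quotients. Independence of
  the splitting is then contained in the classification of the equivalences between models.\<close>

section \<open>Abelian groups and quotients\<close>

text \<open>
  Each variable \<open>aa, ba, \<dots>\<close> has its opposite as a separate variable \<open>ab, bb, \<dots>\<close>, so that ordered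
  rewriting places them next to each other, where they cancel.
\<close>

lemma cyclic_cancel_opposites:
  assumes "abelian_group G"
    and [simp]: "aa \<in> carrier G" "ab \<in> carrier G" "ba \<in> carrier G" "bb \<in> carrier G" "ca \<in> carrier G" "cb \<in> carrier G"
      "da \<in> carrier G" "db \<in> carrier G" "ea \<in> carrier G" "eb \<in> carrier G" "fa \<in> carrier G" "fb \<in> carrier G"
      "ub \<in> carrier G" "va \<in> carrier G" "vb \<in> carrier G" "wa \<in> carrier G" "wb \<in> carrier G" "ua \<in> carrier G"
    and eq: "aa \<oplus>\<^bsub>G\<^esub> ab = \<zero>\<^bsub>G\<^esub>" "ba \<oplus>\<^bsub>G\<^esub> bb = \<zero>\<^bsub>G\<^esub>" "ca \<oplus>\<^bsub>G\<^esub> cb = \<zero>\<^bsub>G\<^esub>" "da \<oplus>\<^bsub>G\<^esub> db = \<zero>\<^bsub>G\<^esub>" "ea \<oplus>\<^bsub>G\<^esub> eb = \<zero>\<^bsub>G\<^esub>" "fa \<oplus>\<^bsub>G\<^esub> fb = \<zero>\<^bsub>G\<^esub>"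
  shows "(aa \<oplus>\<^bsub>G\<^esub> bb \<oplus>\<^bsub>G\<^esub> ua \<oplus>\<^bsub>G\<^esub> (cb \<oplus>\<^bsub>G\<^esub> da) \<oplus>\<^bsub>G\<^esub> ub)
    \<oplus>\<^bsub>G\<^esub> (ca \<oplus>\<^bsub>G\<^esub> eb \<oplus>\<^bsub>G\<^esub> va \<oplus>\<^bsub>G\<^esub> (fb \<oplus>\<^bsub>G\<^esub> ba) \<oplus>\<^bsub>G\<^esub> vb)
    \<oplus>\<^bsub>G\<^esub> (fa \<oplus>\<^bsub>G\<^esub> db \<oplus>\<^bsub>G\<^esub> wa \<oplus>\<^bsub>G\<^esub> (ab \<oplus>\<^bsub>G\<^esub> ea) \<oplus>\<^bsub>G\<^esub> wb) =
    ua \<oplus>\<^bsub>G\<^esub> va \<oplus>\<^bsub>G\<^esub> wa \<oplus>\<^bsub>G\<^esub> (ub \<oplus>\<^bsub>G\<^esub> vb \<oplus>\<^bsub>G\<^esub> wb)"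
proof -
  interpret abelian_group G by fact
  have *: "p \<oplus>\<^bsub>G\<^esub> (q \<oplus>\<^bsub>G\<^esub> z) = z" if "p \<oplus>\<^bsub>G\<^esub> q = \<zero>\<^bsub>G\<^esub>" "p \<in> carrier G" "q \<in> carrier G" "z \<in> carrier G" for p q z
    using that by (metis a_assoc l_zero)
  show ?thesis
    by (simp add: a_ac eq *[OF eq(1)] *[OF eq(2)] *[OF eq(3)] *[OF eq(4)] *[OF eq(5)] *[OF eq(6)])
qed

text \<open>This is the shape of the \<open>M\<close>-component of the Jacobi sum in a model:
  \<open>a\<close> to \<open>f\<close> are the six double actions, each occurring once with either
  sign; the \<open>u\<close> and \<open>v\<close> are the terms that contain the cocycle.\<close>

lemma (in abelian_group) cyclic_cancel:
  assumes "a \<in> carrier G" "b \<in> carrier G" "c \<in> carrier G" "d \<in> carrier G" "e \<in> carrier G" "f \<in> carrier G"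
    "u1 \<in> carrier G" "u2 \<in> carrier G" "u3 \<in> carrier G" "v1 \<in> carrier G" "v2 \<in> carrier G" "v3 \<in> carrier G"
  shows "(a \<ominus> b \<oplus> u1 \<ominus> (c \<ominus> d) \<oplus> v1) \<oplus> (c \<ominus> e \<oplus> u2 \<ominus> (f \<ominus> b) \<oplus> v2) \<oplus> (f \<ominus> d \<oplus> u3 \<ominus> (a \<ominus> e) \<oplus> v3) =
    u1 \<oplus> u2 \<oplus> u3 \<oplus> (v1 \<oplus> v2 \<oplus> v3)"
  using cyclic_cancel_opposites[OF abelian_group_axioms, of a "\<ominus> a" b "\<ominus> b" c "\<ominus> c" d "\<ominus> d" e "\<ominus> e" f "\<ominus> f" v1 u2 v2 u3 v3 u1] assms
  by (simp add: a_minus_def minus_add r_neg)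

lemma (in abelian_group) neg_zero: "\<ominus> \<zero> = \<zero>"
  by (rule minus_equality) simp_all

lemma (in abelian_group) diff_eq_diff:
  assumes "a \<oplus> b = c \<oplus> d" "a \<in> carrier G" "b \<in> carrier G" "c \<in> carrier G" "d \<in> carrier G"
  shows "b \<ominus> d = c \<ominus> a"
proof -
  have "b \<ominus> d = \<ominus> a \<oplus> (a \<oplus> b) \<oplus> \<ominus> d"
    using assms(2-) by (simp add: a_minus_def a_assoc[symmetric] l_neg)
  also have "\<dots> = c \<ominus> a \<oplus> (d \<oplus> \<ominus> d)"
    unfolding assms(1) using assms(2-) by (simp add: a_minus_def a_ac)
  also have "\<dots> = c \<ominus> a"
    using assms(2-) by (simp add: r_neg)
  finally show ?thesis .
qed

text \<open>A correspondence \<open>C\<close> replaces a map on representatives, so nothing has to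
  be chosen: a class goes to the set of all partners of its members, which is the class of any one
  partner. That \<open>s\<close> behaves as an equivalence is inherited from \<open>r\<close>
  through \<open>C\<close>.\<close>

lemma quotient_bij_betw:
  assumes equiv: "equiv X r" and r: "r \<subseteq> X \<times> X" and s: "s \<subseteq> Y \<times> Y"
    and C: "\<And>x y. C x y \<Longrightarrow> x \<in> X \<and> y \<in> Y"
    and total: "\<And>x. x \<in> X \<Longrightarrow> \<exists>y. C x y" and onto: "\<And>y. y \<in> Y \<Longrightarrow> \<exists>x. C x y"
    and iff: "\<And>x x' y y'. C x y \<Longrightarrow> C x' y' \<Longrightarrow> (x, x') \<in> r \<longleftrightarrow> (y, y') \<in> s"
  shows "\<exists>F. bij_betw F (X // r) (Y // s)"
proof -
  let ?F = "\<lambda>K. {y. \<exists>x\<in>K. C x y}"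
  have F: "?F (r `` {x}) = s `` {y}" if "C x y" for x y
    using that iff onto s by blast
  have refl: "(x, x) \<in> r" if "x \<in> X" for x
    using equiv that by (auto simp: equiv_def refl_on_def)
  have "inj_on ?F (X // r)"
  proof (rule inj_onI)
    fix K K' assume K: "K \<in> X // r" "K' \<in> X // r" and eq: "?F K = ?F K'"
    then obtain x x' where x: "K = r `` {x}" "x \<in> X" "K' = r `` {x'}" "x' \<in> X"
      by (auto elim!: quotientE)
    obtain y y' where y: "C x y" "C x' y'" using total x by blast
    \<comment> \<open>Reflexivity of \<open>s\<close> at \<open>y'\<close> comes from that of
      \<open>r\<close> at \<open>x'\<close>. It puts \<open>y'\<close> into the image of the second
      class, hence into that of the first, which is the class of \<open>y\<close>.\<close>
    have "(y', y') \<in> s" using iff[OF y(2) y(2)] refl[OF x(4)] by simp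
    then have "(y, y') \<in> s" using eq unfolding x F[OF y(1)] F[OF y(2)] by blast
    then show "K = K'" unfolding x using iff[OF y] equiv by (simp add: equiv_class_eq)
  qed
  moreover have "?F ` (X // r) = Y // s"
  proof (intro equalityI subsetI)
    fix K assume "K \<in> ?F ` (X // r)"
    then obtain x where x: "x \<in> X" "K = ?F (r `` {x})" by (auto elim!: quotientE)
    obtain y where "C x y" using total x by blast
    then show "K \<in> Y // s" using F C x by (auto intro: quotientI)
  next
    fix K assume "K \<in> Y // s"
    then obtain y where y: "y \<in> Y" "K = s `` {y}" by (auto elim!: quotientE)
    then obtain x where "C x y" using onto by blast
    then show "K \<in> ?F ` (X // r)" using F C y by (auto intro!: image_eqI[of _ _ "r `` {x}"] quotientI)
  qed
  ultimately show ?thesis by (auto simp: bij_betw_def)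
qed

section \<open>Linear maps\<close>

lemma restrict_scalars_simps [simp]:
  "carrier (restrict_scalars A M) = carrier M"
  "zero (restrict_scalars A M) = zero M"
  "add (restrict_scalars A M) = add M"
  "smult (restrict_scalars A M) r m = (r \<odot>\<^bsub>A\<^esub> \<one>\<^bsub>A\<^esub>) \<odot>\<^bsub>M\<^esub> m"
  "a_inv (restrict_scalars A M) = a_inv M"
  "a_minus (restrict_scalars A M) = a_minus M"
  by (simp_all add: restrict_scalars_def a_inv_def a_minus_def m_inv_def fun_eq_iff)

text \<open>Scalars are pulled back along the ring homomorphism sending r to r.1; the algebra axioms
  are what makes this map multiplicative.\<close>

lemma restrict_scalars_module:
  assumes "algebra R A" "module A M"
  shows "module R (restrict_scalars A M)"
proof -
  interpret A: algebra R A by fact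
  interpret M: module A M by fact
  have closed: "r \<odot>\<^bsub>A\<^esub> \<one>\<^bsub>A\<^esub> \<in> carrier A" if "r \<in> carrier R" for r
    using that by simp
  have mult: "(r \<otimes>\<^bsub>R\<^esub> s) \<odot>\<^bsub>A\<^esub> \<one>\<^bsub>A\<^esub> = (r \<odot>\<^bsub>A\<^esub> \<one>\<^bsub>A\<^esub>) \<otimes>\<^bsub>A\<^esub> (s \<odot>\<^bsub>A\<^esub> \<one>\<^bsub>A\<^esub>)"
    if "r \<in> carrier R" "s \<in> carrier R" for r s
    using that by (simp add: A.smult_assoc1 A.smult_assoc2)
  show ?thesis
  proof (rule moduleI)
    show "abelian_group (restrict_scalars A M)"
      by (rule abelian_groupI)
        (auto simp: M.a_ac intro: bexI[of _ "\<ominus>\<^bsub>M\<^esub> _"] M.l_neg)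
  qed (use closed mult in \<open>auto simp: A.R_cring A.smult_l_distr M.smult_l_distr M.smult_r_distr M.smult_assoc1\<close>)
qed

lemma linear_map_zero:
  assumes "module A V" "module A W" "linear_map A V W f"
  shows "f \<zero>\<^bsub>V\<^esub> = \<zero>\<^bsub>W\<^esub>"
proof -
  interpret V: module A V by fact
  interpret W: module A W by fact
  have "f (\<zero>\<^bsub>A\<^esub> \<odot>\<^bsub>V\<^esub> \<zero>\<^bsub>V\<^esub>) = \<zero>\<^bsub>A\<^esub> \<odot>\<^bsub>W\<^esub> f \<zero>\<^bsub>V\<^esub>" "f \<zero>\<^bsub>V\<^esub> \<in> carrier W"
    using assms(3) V.R.zero_closed V.zero_closed unfolding linear_map_def by blast+
  then show ?thesis by simp
qed

lemma linear_map_minus: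
  assumes "module A V" "module A W" "linear_map A V W f" "x \<in> carrier V"
  shows "f (\<ominus>\<^bsub>V\<^esub> x) = \<ominus>\<^bsub>W\<^esub> f x"
proof -
  interpret V: module A V by fact
  interpret W: module A W by fact
  have "f (\<ominus>\<^bsub>V\<^esub> x) \<oplus>\<^bsub>W\<^esub> f x = f (\<ominus>\<^bsub>V\<^esub> x \<oplus>\<^bsub>V\<^esub> x)" "f x \<in> carrier W" "f (\<ominus>\<^bsub>V\<^esub> x) \<in> carrier W"
    using assms(3,4) V.a_inv_closed[OF assms(4)] unfolding linear_map_def by auto
  moreover have "f (\<ominus>\<^bsub>V\<^esub> x \<oplus>\<^bsub>V\<^esub> x) = \<zero>\<^bsub>W\<^esub>"
    using linear_map_zero[OF assms(1-3)] assms(4) by (simp add: V.l_neg)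
  ultimately show ?thesis by (metis W.minus_equality)
qed

lemma linear_map_diff:
  assumes "module A V" "module A W" "linear_map A V W f" "x \<in> carrier V" "y \<in> carrier V"
  shows "f (x \<ominus>\<^bsub>V\<^esub> y) = f x \<ominus>\<^bsub>W\<^esub> f y"
proof -
  interpret V: module A V by fact
  have "f (x \<oplus>\<^bsub>V\<^esub> (\<ominus>\<^bsub>V\<^esub> y)) = f x \<oplus>\<^bsub>W\<^esub> f (\<ominus>\<^bsub>V\<^esub> y)"
    using assms(3-5) V.a_inv_closed[OF assms(5)] unfolding linear_map_def by auto
  then show ?thesis
    using linear_map_minus[OF assms(1-3,5)] by (simp add: a_minus_def)
qed

section \<open>Hom-Lie-Rinehart algebras and their modules\<close>

text \<open>The calculation rules are collected once, because they are needed for the base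
  \<open>L\<close>, for the middle terms of extensions and for the kernel.\<close>

locale hLR =
  fixes R :: "('r, 'c) ring_scheme" and A :: "('r, 'a, 'd) module_scheme"
    and \<phi> :: "'a \<Rightarrow> 'a" and L :: "('a, 'l) hlr"
  assumes hLR: "hom_Lie_Rinehart R A \<phi> L"
begin

lemma alg: "algebra R A" and mod: "module A L"
  using hLR by (auto simp: hom_Lie_Rinehart_def faithful_module_def)

sublocale algebra: algebra R A by (rule alg)
sublocale L: module A L by (rule mod)

lemma phi_closed [simp]: "a \<in> carrier A \<Longrightarrow> \<phi> a \<in> carrier A"
  using hLR by (auto simp: hom_Lie_Rinehart_def algebra_endomorphism_def linear_map_def)

text \<open>An \<open>R\<close>-linear unital map fixes the image of \<open>R\<close> in
  \<open>A\<close>. Hence \<phi>-semilinear and \<phi>-linear maps over \<open>A\<close> are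
  \<open>R\<close>-linear, and the rules for scalars from \<open>A\<close> also settle
  \<open>R\<close>-linearity.\<close>

lemma phi_scalar [simp]:
  assumes "r \<in> carrier R"
  shows "\<phi> (r \<odot>\<^bsub>A\<^esub> \<one>\<^bsub>A\<^esub>) = r \<odot>\<^bsub>A\<^esub> \<one>\<^bsub>A\<^esub>"
proof -
  have "\<phi> \<one>\<^bsub>A\<^esub> = \<one>\<^bsub>A\<^esub>" "\<phi> (r \<odot>\<^bsub>A\<^esub> \<one>\<^bsub>A\<^esub>) = r \<odot>\<^bsub>A\<^esub> \<phi> \<one>\<^bsub>A\<^esub>"
    using hLR assms algebra.one_closed
    unfolding hom_Lie_Rinehart_def algebra_endomorphism_def linear_map_def ring_hom_def by blast+
  then show ?thesis by simp
qed

lemma bracket_closed [simp]: "x \<in> carrier L \<Longrightarrow> y \<in> carrier L \<Longrightarrow> bracket L x y \<in> carrier L"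
  and bracket_add_left: "\<lbrakk>x \<in> carrier L; y \<in> carrier L; z \<in> carrier L\<rbrakk> \<Longrightarrow>
    bracket L (x \<oplus>\<^bsub>L\<^esub> y) z = bracket L x z \<oplus>\<^bsub>L\<^esub> bracket L y z"
  and bracket_add_right: "\<lbrakk>x \<in> carrier L; y \<in> carrier L; z \<in> carrier L\<rbrakk> \<Longrightarrow>
    bracket L x (y \<oplus>\<^bsub>L\<^esub> z) = bracket L x y \<oplus>\<^bsub>L\<^esub> bracket L x z"
  and bracket_self [simp]: "x \<in> carrier L \<Longrightarrow> bracket L x x = \<zero>\<^bsub>L\<^esub>"
  and twist_closed [simp]: "x \<in> carrier L \<Longrightarrow> twist L x \<in> carrier L"
  and twist_add: "x \<in> carrier L \<Longrightarrow> y \<in> carrier L \<Longrightarrow> twist L (x \<oplus>\<^bsub>L\<^esub> y) = twist L x \<oplus>\<^bsub>L\<^esub> twist L y"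
  and twist_bracket: "x \<in> carrier L \<Longrightarrow> y \<in> carrier L \<Longrightarrow>
    twist L (bracket L x y) = bracket L (twist L x) (twist L y)"
  and jacobi: "\<lbrakk>x \<in> carrier L; y \<in> carrier L; z \<in> carrier L\<rbrakk> \<Longrightarrow>
    bracket L (twist L x) (bracket L y z) \<oplus>\<^bsub>L\<^esub> bracket L (twist L y) (bracket L z x)
      \<oplus>\<^bsub>L\<^esub> bracket L (twist L z) (bracket L x y) = \<zero>\<^bsub>L\<^esub>"
  and twist_smult: "a \<in> carrier A \<Longrightarrow> x \<in> carrier L \<Longrightarrow> twist L (a \<odot>\<^bsub>L\<^esub> x) = \<phi> a \<odot>\<^bsub>L\<^esub> twist L x"
  and bracket_scalar_left: "\<lbrakk>r \<in> carrier R; x \<in> carrier L; y \<in> carrier L\<rbrakk> \<Longrightarrow>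
    bracket L ((r \<odot>\<^bsub>A\<^esub> \<one>\<^bsub>A\<^esub>) \<odot>\<^bsub>L\<^esub> x) y = (r \<odot>\<^bsub>A\<^esub> \<one>\<^bsub>A\<^esub>) \<odot>\<^bsub>L\<^esub> bracket L x y"
  and bracket_scalar_right: "\<lbrakk>r \<in> carrier R; x \<in> carrier L; y \<in> carrier L\<rbrakk> \<Longrightarrow>
    bracket L x ((r \<odot>\<^bsub>A\<^esub> \<one>\<^bsub>A\<^esub>) \<odot>\<^bsub>L\<^esub> y) = (r \<odot>\<^bsub>A\<^esub> \<one>\<^bsub>A\<^esub>) \<odot>\<^bsub>L\<^esub> bracket L x y"
  and bracket_smult_right: "\<lbrakk>a \<in> carrier A; x \<in> carrier L; y \<in> carrier L\<rbrakk> \<Longrightarrow>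
    bracket L x (a \<odot>\<^bsub>L\<^esub> y) = \<phi> a \<odot>\<^bsub>L\<^esub> bracket L x y \<oplus>\<^bsub>L\<^esub> anchor L x a \<odot>\<^bsub>L\<^esub> twist L y"
  using hLR
  by (auto simp: hom_Lie_Rinehart_def hom_Lie_algebra_def bilinear_map_def linear_map_def)

lemma anchor_closed [simp]: "x \<in> carrier L \<Longrightarrow> a \<in> carrier A \<Longrightarrow> anchor L x a \<in> carrier A"
  using hLR unfolding hom_Lie_Rinehart_def phi_derivations_def linear_map_def by blast

lemma bracket_skew:
  assumes x: "x \<in> carrier L" and y: "y \<in> carrier L"
  shows "bracket L x y = \<ominus>\<^bsub>L\<^esub> bracket L y x"
proof -
  have "bracket L x y \<oplus>\<^bsub>L\<^esub> bracket L y x = bracket L (x \<oplus>\<^bsub>L\<^esub> y) (x \<oplus>\<^bsub>L\<^esub> y)"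
    unfolding bracket_add_left[OF x y L.a_closed[OF x y]]
    using x y by (simp add: bracket_add_right)
  also have "\<dots> = \<zero>\<^bsub>L\<^esub>" using x y by simp
  finally show ?thesis using x y by (simp add: L.M.minus_equality)
qed

lemma anchor_add_left: "\<lbrakk>x \<in> carrier L; y \<in> carrier L; a \<in> carrier A\<rbrakk> \<Longrightarrow>
    anchor L (x \<oplus>\<^bsub>L\<^esub> y) a = anchor L x a \<oplus>\<^bsub>A\<^esub> anchor L y a"
  and anchor_scalar_left: "\<lbrakk>r \<in> carrier R; x \<in> carrier L; a \<in> carrier A\<rbrakk> \<Longrightarrow>
    anchor L ((r \<odot>\<^bsub>A\<^esub> \<one>\<^bsub>A\<^esub>) \<odot>\<^bsub>L\<^esub> x) a = r \<odot>\<^bsub>A\<^esub> anchor L x a"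
  and anchor_linear: "x \<in> carrier L \<Longrightarrow> linear_map R A A (anchor L x)"
  and anchor_derivation: "x \<in> carrier L \<Longrightarrow> anchor L x \<in> phi_derivations R A \<phi>"
  and anchor_smult: "\<lbrakk>a \<in> carrier A; x \<in> carrier L; b \<in> carrier A\<rbrakk> \<Longrightarrow>
    anchor L (a \<odot>\<^bsub>L\<^esub> x) b = \<phi> a \<otimes>\<^bsub>A\<^esub> anchor L x b"
  and anchor_twist: "\<lbrakk>x \<in> carrier L; a \<in> carrier A\<rbrakk> \<Longrightarrow> anchor L (twist L x) (\<phi> a) = \<phi> (anchor L x a)"
  and anchor_bracket: "\<lbrakk>x \<in> carrier L; y \<in> carrier L; a \<in> carrier A\<rbrakk> \<Longrightarrow>
    anchor L (bracket L x y) (\<phi> a) =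
      anchor L (twist L x) (anchor L y a) \<ominus>\<^bsub>A\<^esub> anchor L (twist L y) (anchor L x a)"
  and phi_linear: "linear_map R A A \<phi>"
  and alg_endo: "algebra_endomorphism R A \<phi>"
  and module_RA: "module R A"
  and faithful: "faithful_module A L"
  using hLR
  by (auto simp: hom_Lie_Rinehart_def hom_Lie_representation_def bilinear_map_def linear_map_def)

lemma bracket_zero_right [simp]:
  assumes x: "x \<in> carrier L" shows "bracket L x \<zero>\<^bsub>L\<^esub> = \<zero>\<^bsub>L\<^esub>"
  using bracket_add_right[OF x L.M.zero_closed L.M.zero_closed] x
    L.M.add.l_cancel_one'[of "bracket L x \<zero>\<^bsub>L\<^esub>" "bracket L x \<zero>\<^bsub>L\<^esub>"] by simp

lemma twist_zero [simp]: "twist L \<zero>\<^bsub>L\<^esub> = \<zero>\<^bsub>L\<^esub>"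
  using twist_add[OF L.M.zero_closed L.M.zero_closed]
    L.M.add.l_cancel_one'[of "twist L \<zero>\<^bsub>L\<^esub>" "twist L \<zero>\<^bsub>L\<^esub>"] by simp

lemma anchor_zero [simp]: "a \<in> carrier A \<Longrightarrow> anchor L \<zero>\<^bsub>L\<^esub> a = \<zero>\<^bsub>A\<^esub>"
  using anchor_add_left[OF L.M.zero_closed L.M.zero_closed, of a]
    algebra.add.l_cancel_one'[of "anchor L \<zero>\<^bsub>L\<^esub> a" "anchor L \<zero>\<^bsub>L\<^esub> a"] by simp

text \<open>Skew-symmetry turns the Leibniz rule of the second argument into one for the first; the
  anchor term changes its sign on the way.\<close>

lemma bracket_smult_left:
  assumes "a \<in> carrier A" "x \<in> carrier L" "y \<in> carrier L"
  shows "bracket L (a \<odot>\<^bsub>L\<^esub> x) y = \<phi> a \<odot>\<^bsub>L\<^esub> bracket L x y \<ominus>\<^bsub>L\<^esub> anchor L y a \<odot>\<^bsub>L\<^esub> twist L x"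
proof -
  have "bracket L (a \<odot>\<^bsub>L\<^esub> x) y = \<ominus>\<^bsub>L\<^esub> (\<phi> a \<odot>\<^bsub>L\<^esub> (\<ominus>\<^bsub>L\<^esub> bracket L x y) \<oplus>\<^bsub>L\<^esub> anchor L y a \<odot>\<^bsub>L\<^esub> twist L x)"
    using assms bracket_skew[of "a \<odot>\<^bsub>L\<^esub> x" y] bracket_skew[of y x]
    by (simp add: bracket_smult_right)
  then show ?thesis
    using assms by (simp add: L.smult_r_minus L.M.minus_add a_minus_def)
qed

end

section \<open>Argument lists of cochains in degrees one to three\<close>

lemma tuples_1: "tuples V (Suc 0) = (\<lambda>x. [x]) ` carrier V"
  by (auto simp: tuples_def length_Suc_conv)

lemma tuples_2: "tuples V 2 = (\<lambda>(x, y). [x, y]) ` (carrier V \<times> carrier V)"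
  by (auto simp: tuples_def length_Suc_conv numeral_2_eq_2)

lemma tuples_3: "tuples V 3 = (\<lambda>(x, y, z). [x, y, z]) ` (carrier V \<times> carrier V \<times> carrier V)"
  by (auto simp: tuples_def length_Suc_conv numeral_3_eq_3 image_iff)

lemma all_less_2: "(\<forall>i<(2::nat). P i) \<longleftrightarrow> P 0 \<and> P 1"
  by (auto simp: numeral_2_eq_2 less_Suc_eq)

section \<open>Left modules over a hom-Lie-Rinehart algebra\<close>

locale hLR_module = hLR R A \<phi> L
  for R :: "('r, 'c) ring_scheme" and A :: "('r, 'a, 'd) module_scheme"
    and \<phi> :: "'a \<Rightarrow> 'a" and L :: "('a, 'l) hlr" +
  fixes M :: "('a, 'l, 'm) hlr_module"
  assumes left_module: "left_module R A \<phi> L M"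
begin

lemma module_M: "module A M"
  using left_module by (simp add: left_module_def faithful_module_def)

sublocale M: module A M by (rule module_M)

lemma action_closed [simp]: "x \<in> carrier L \<Longrightarrow> m \<in> carrier M \<Longrightarrow> action M x m \<in> carrier M"
  and action_add_left: "\<lbrakk>x \<in> carrier L; y \<in> carrier L; m \<in> carrier M\<rbrakk> \<Longrightarrow>
    action M (x \<oplus>\<^bsub>L\<^esub> y) m = action M x m \<oplus>\<^bsub>M\<^esub> action M y m"
  and action_add_right: "\<lbrakk>x \<in> carrier L; m \<in> carrier M; n \<in> carrier M\<rbrakk> \<Longrightarrow>
    action M x (m \<oplus>\<^bsub>M\<^esub> n) = action M x m \<oplus>\<^bsub>M\<^esub> action M x n"
  and action_scalar_right: "\<lbrakk>r \<in> carrier R; x \<in> carrier L; m \<in> carrier M\<rbrakk> \<Longrightarrow>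
    action M x ((r \<odot>\<^bsub>A\<^esub> \<one>\<^bsub>A\<^esub>) \<odot>\<^bsub>M\<^esub> m) = (r \<odot>\<^bsub>A\<^esub> \<one>\<^bsub>A\<^esub>) \<odot>\<^bsub>M\<^esub> action M x m"
  and endo_closed [simp]: "m \<in> carrier M \<Longrightarrow> endo M m \<in> carrier M"
  and endo_add: "m \<in> carrier M \<Longrightarrow> n \<in> carrier M \<Longrightarrow> endo M (m \<oplus>\<^bsub>M\<^esub> n) = endo M m \<oplus>\<^bsub>M\<^esub> endo M n"
  and endo_action: "x \<in> carrier L \<Longrightarrow> m \<in> carrier M \<Longrightarrow>
    endo M (action M x m) = action M (twist L x) (endo M m)"
  and action_bracket: "\<lbrakk>x \<in> carrier L; y \<in> carrier L; m \<in> carrier M\<rbrakk> \<Longrightarrow>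
    action M (bracket L x y) (endo M m) =
      action M (twist L x) (action M y m) \<ominus>\<^bsub>M\<^esub> action M (twist L y) (action M x m)"
  and endo_smult: "a \<in> carrier A \<Longrightarrow> m \<in> carrier M \<Longrightarrow> endo M (a \<odot>\<^bsub>M\<^esub> m) = \<phi> a \<odot>\<^bsub>M\<^esub> endo M m"
  and action_smult_left: "\<lbrakk>a \<in> carrier A; x \<in> carrier L; m \<in> carrier M\<rbrakk> \<Longrightarrow>
    action M (a \<odot>\<^bsub>L\<^esub> x) m = \<phi> a \<odot>\<^bsub>M\<^esub> action M x m"
  and action_smult_right: "\<lbrakk>a \<in> carrier A; x \<in> carrier L; m \<in> carrier M\<rbrakk> \<Longrightarrow>
    action M x (a \<odot>\<^bsub>M\<^esub> m) = \<phi> a \<odot>\<^bsub>M\<^esub> action M x m \<oplus>\<^bsub>M\<^esub> anchor L x a \<odot>\<^bsub>M\<^esub> endo M m"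
  using left_module
  by (auto simp: left_module_def hom_Lie_representation_def bilinear_map_def linear_map_def)

lemma restrict_module_L: "module R (restrict_scalars A L)"
  and restrict_module_M: "module R (restrict_scalars A M)"
  by (rule restrict_scalars_module alg mod module_M)+

lemma linear_action: "x \<in> carrier L \<Longrightarrow> linear_map R (restrict_scalars A M) (restrict_scalars A M) (action M x)"
  and linear_action_left: "m \<in> carrier M \<Longrightarrow> linear_map R (restrict_scalars A L) (restrict_scalars A M) (\<lambda>x. action M x m)"
  and linear_endo: "linear_map R (restrict_scalars A M) (restrict_scalars A M) (endo M)"
  using left_module
  by (auto simp: left_module_def hom_Lie_representation_def bilinear_map_def)

lemma action_zero_right [simp]: "x \<in> carrier L \<Longrightarrow> action M x \<zero>\<^bsub>M\<^esub> = \<zero>\<^bsub>M\<^esub>"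
  and action_minus_right: "x \<in> carrier L \<Longrightarrow> m \<in> carrier M \<Longrightarrow> action M x (\<ominus>\<^bsub>M\<^esub> m) = \<ominus>\<^bsub>M\<^esub> action M x m"
  and action_zero_left [simp]: "m \<in> carrier M \<Longrightarrow> action M \<zero>\<^bsub>L\<^esub> m = \<zero>\<^bsub>M\<^esub>"
  and endo_zero [simp]: "endo M \<zero>\<^bsub>M\<^esub> = \<zero>\<^bsub>M\<^esub>"
  and endo_minus: "m \<in> carrier M \<Longrightarrow> endo M (\<ominus>\<^bsub>M\<^esub> m) = \<ominus>\<^bsub>M\<^esub> endo M m"
  using linear_map_zero[OF restrict_module_M restrict_module_M linear_action]
    linear_map_minus[OF restrict_module_M restrict_module_M linear_action]
    linear_map_zero[OF restrict_module_L restrict_module_M linear_action_left]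
    linear_map_zero[OF restrict_module_M restrict_module_M linear_endo]
    linear_map_minus[OF restrict_module_M restrict_module_M linear_endo]
  by simp_all

subsection \<open>Cochains in low degrees\<close>

text \<open>The curried form of a 2-cocycle, free of lists. The last clause is \<delta> c = 0 in
  cyclic form, with the brackets moved into the second argument. The scalar is \<phi>(a) because the
  exponent n - 1 is 1, and \<open>R\<close>-linearity is the case of scalars r.1, which \<phi>
  fixes.\<close>

definition two_cocycle :: "('l \<Rightarrow> 'l \<Rightarrow> 'm) \<Rightarrow> bool" where
  "two_cocycle c \<longleftrightarrow>
     (\<forall>x\<in>carrier L. \<forall>y\<in>carrier L. c x y \<in> carrier M) \<and>
     (\<forall>x\<in>carrier L. \<forall>y\<in>carrier L. \<forall>z\<in>carrier L. c (x \<oplus>\<^bsub>L\<^esub> y) z = c x z \<oplus>\<^bsub>M\<^esub> c y z) \<and>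
     (\<forall>x\<in>carrier L. \<forall>y\<in>carrier L. \<forall>z\<in>carrier L. c x (y \<oplus>\<^bsub>L\<^esub> z) = c x y \<oplus>\<^bsub>M\<^esub> c x z) \<and>
     (\<forall>x\<in>carrier L. c x x = \<zero>\<^bsub>M\<^esub>) \<and>
     (\<forall>x\<in>carrier L. \<forall>y\<in>carrier L. c (twist L x) (twist L y) = endo M (c x y)) \<and>
     (\<forall>a\<in>carrier A. \<forall>x\<in>carrier L. \<forall>y\<in>carrier L.
        c (a \<odot>\<^bsub>L\<^esub> x) y = \<phi> a \<odot>\<^bsub>M\<^esub> c x y \<and> c x (a \<odot>\<^bsub>L\<^esub> y) = \<phi> a \<odot>\<^bsub>M\<^esub> c x y) \<and>
     (\<forall>x\<in>carrier L. \<forall>y\<in>carrier L. \<forall>z\<in>carrier L.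
        action M (twist L x) (c y z) \<oplus>\<^bsub>M\<^esub> action M (twist L y) (c z x) \<oplus>\<^bsub>M\<^esub> action M (twist L z) (c x y)
        \<oplus>\<^bsub>M\<^esub> (c (twist L x) (bracket L y z) \<oplus>\<^bsub>M\<^esub> c (twist L y) (bracket L z x)
        \<oplus>\<^bsub>M\<^esub> c (twist L z) (bracket L x y)) = \<zero>\<^bsub>M\<^esub>)"

text \<open>In degree 1 the exponent of \<phi> is 0, so cochains are honestly
  \<open>A\<close>-linear.\<close>

definition one_cochain :: "('l \<Rightarrow> 'm) \<Rightarrow> bool" where
  "one_cochain h \<longleftrightarrow> linear_map A L M h \<and> (\<forall>x\<in>carrier L. h (twist L x) = endo M (h x))"

lemma add_pow_signs [simp]:
  assumes "m \<in> carrier M"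
  shows "[(1::int)] \<cdot>\<^bsub>M\<^esub> m = m" "[(-1::int)] \<cdot>\<^bsub>M\<^esub> m = \<ominus>\<^bsub>M\<^esub> m"
  using assms by (simp_all add: add_pow_int_ge add_pow_int_lt)

text \<open>The acting elements are not twisted here, since the power of the twist is 0 in degree 1.
  The only bracket term has sign -1, and no entry remains to be twisted in it.\<close>

lemma coboundary_1:
  assumes x: "x \<in> carrier L" and y: "y \<in> carrier L"
    and f: "\<And>x. x \<in> carrier L \<Longrightarrow> f [x] \<in> carrier M"
  shows "coboundary L M 1 f [x, y] =
    action M x (f [y]) \<ominus>\<^bsub>M\<^esub> action M y (f [x]) \<ominus>\<^bsub>M\<^esub> f [bracket L x y]"
proof -
  have "[x, y] \<in> tuples L 2" using x y by (auto simp: tuples_2)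
  then show ?thesis using x y f
    by (simp add: coboundary_def nths_Cons numeral_2_eq_2 lessThan_Suc atMost_Suc a_minus_def M.a_ac Pi_def
        del: M.finsum_Suc M.add.finprod_Suc)
qed

text \<open>Skew-symmetry absorbs the alternating signs and makes the sum cyclic. The term with
  [x, z] also needs \<open>minus\<close>, because this bracket has to become -[z, x] in the second
  argument. Only these properties of \<open>f\<close> are assumed, so that the formula serves both
  for a given cocycle and for one built from a binary map.\<close>

lemma coboundary_2:
  assumes x: "x \<in> carrier L" and y: "y \<in> carrier L" and z: "z \<in> carrier L"
    and f: "\<And>x y. x \<in> carrier L \<Longrightarrow> y \<in> carrier L \<Longrightarrow> f [x, y] \<in> carrier M"
    and skew: "\<And>x y. x \<in> carrier L \<Longrightarrow> y \<in> carrier L \<Longrightarrow> f [x, y] = \<ominus>\<^bsub>M\<^esub> f [y, x]"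
    and minus: "\<And>x y. x \<in> carrier L \<Longrightarrow> y \<in> carrier L \<Longrightarrow> f [x, \<ominus>\<^bsub>L\<^esub> y] = \<ominus>\<^bsub>M\<^esub> f [x, y]"
  shows "coboundary L M 2 f [x, y, z] =
    action M (twist L x) (f [y, z]) \<oplus>\<^bsub>M\<^esub> action M (twist L y) (f [z, x])
      \<oplus>\<^bsub>M\<^esub> action M (twist L z) (f [x, y])
    \<oplus>\<^bsub>M\<^esub> (f [twist L x, bracket L y z] \<oplus>\<^bsub>M\<^esub> f [twist L y, bracket L z x]
      \<oplus>\<^bsub>M\<^esub> f [twist L z, bracket L x y])"
proof -
  have "[x, y, z] \<in> tuples L 3" using x y z by (auto simp: tuples_3 image_iff)
  moreover have "\<ominus>\<^bsub>M\<^esub> f [bracket L x y, twist L z] = f [twist L z, bracket L x y]"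
    "\<ominus>\<^bsub>M\<^esub> f [bracket L y z, twist L x] = f [twist L x, bracket L y z]"
    "f [bracket L x z, twist L y] = f [twist L y, bracket L z x]"
    "\<ominus>\<^bsub>M\<^esub> action M (twist L y) (f [x, z]) = action M (twist L y) (f [z, x])"
    using x y z f skew[of "bracket L x y" "twist L z"] skew[of "bracket L y z" "twist L x"]
      skew[of "bracket L x z" "twist L y"] bracket_skew[of x z] minus[of "twist L y" "bracket L z x"]
      skew[of x z] by (simp_all add: action_minus_right)
  ultimately show ?thesis using x y z f
    by (simp add: coboundary_def nths_Cons numeral_2_eq_2 numeral_3_eq_3 lessThan_Suc atMost_Suc
        a_minus_def M.a_ac Pi_def del: M.finsum_Suc M.add.finprod_Suc)
qed

lemma two_cocycle_if_cocycles:
  assumes f: "f \<in> cocycles R A \<phi> L M 2"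
  shows "two_cocycle (\<lambda>x y. f [x, y])"
proof -
  let ?L = "restrict_scalars A L" and ?M = "restrict_scalars A M"
  have t: "[x, y] \<in> tuples L 2" "[x, y] \<in> tuples ?L 2" if "x \<in> carrier L" "y \<in> carrier L" for x y
    using that by (auto simp: tuples_def)
  have fc: "f \<in> cochains R A \<phi> L M 2" and d: "coboundary L M 2 f = zero_cochain L M 3"
    using f by (auto simp: cocycles_def)
  have alt: "f \<in> alternating_maps R ?L ?M 2"
    using fc by (simp add: cochains_def)
  have closed: "f [x, y] \<in> carrier M" if "x \<in> carrier L" "y \<in> carrier L" for x y
    using alt t[OF that] by (auto simp: alternating_maps_def)
  \<comment> \<open>Linearity in an entry is stated for updated lists; the positions 0 and 1 give
    linearity in the first and in the second argument.\<close>
  have lin: "linear_map R ?L ?M (\<lambda>z. f ([x, y][i := z]))"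
    if "x \<in> carrier L" "y \<in> carrier L" "i < 2" for x y i
    using alt t(2)[OF that(1,2)] that(3) unfolding alternating_maps_def by blast
  have lin1: "linear_map R ?L ?M (\<lambda>x. f [x, y])" and lin2: "linear_map R ?L ?M (\<lambda>x. f [y, x])"
    if "y \<in> carrier L" for y
    using lin[OF that that, of 0] lin[OF that that, of 1] by simp_all
  have add: "f [x \<oplus>\<^bsub>L\<^esub> y, z] = f [x, z] \<oplus>\<^bsub>M\<^esub> f [y, z]" "f [z, x \<oplus>\<^bsub>L\<^esub> y] = f [z, x] \<oplus>\<^bsub>M\<^esub> f [z, y]"
    if "x \<in> carrier L" "y \<in> carrier L" "z \<in> carrier L" for x y z
    using lin1[OF that(3)] lin2[OF that(3)] that by (simp_all add: linear_map_def)
  have self: "f [x, x] = \<zero>\<^bsub>M\<^esub>" if "x \<in> carrier L" for x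
  proof -
    have "\<forall>i<2. \<forall>j<2. i \<noteq> j \<and> [x, x] ! i = [x, x] ! j \<longrightarrow> f [x, x] = \<zero>\<^bsub>M\<^esub>"
      using alt t that unfolding alternating_maps_def by auto
    then show ?thesis by (auto simp: all_less_2)
  qed
  have skew: "f [x, y] = \<ominus>\<^bsub>M\<^esub> f [y, x]" if "x \<in> carrier L" "y \<in> carrier L" for x y
  proof -
    have "f [x, y] \<oplus>\<^bsub>M\<^esub> f [y, x] = f [x \<oplus>\<^bsub>L\<^esub> y, x \<oplus>\<^bsub>L\<^esub> y]"
      unfolding add(1)[OF that L.a_closed[OF that]] using that by (simp add: add(2) self closed)
    also have "\<dots> = \<zero>\<^bsub>M\<^esub>" using that by (simp add: self)
    finally show ?thesis using that by (simp add: M.M.minus_equality closed)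
  qed
  have minus: "f [x, \<ominus>\<^bsub>L\<^esub> y] = \<ominus>\<^bsub>M\<^esub> f [x, y]" if "x \<in> carrier L" "y \<in> carrier L" for x y
    using linear_map_minus[OF restrict_module_L restrict_module_M lin2] that by simp
  have twist: "f [twist L x, twist L y] = endo M (f [x, y])" if "x \<in> carrier L" "y \<in> carrier L" for x y
    using fc t[OF that] by (auto simp: cochains_def)
  \<comment> \<open>The power of \<phi> in the cochain condition has exponent 2 - 1, so it is \<phi>
    itself.\<close>
  have "\<forall>i<2. \<forall>a\<in>carrier A. f ([x, y][i := a \<odot>\<^bsub>L\<^esub> [x, y] ! i]) = \<phi> a \<odot>\<^bsub>M\<^esub> f [x, y]"
    if "x \<in> carrier L" "y \<in> carrier L" for x y
    using fc t(1)[OF that] by (simp add: cochains_def del: list_update.simps)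
  then have smult: "f [a \<odot>\<^bsub>L\<^esub> x, y] = \<phi> a \<odot>\<^bsub>M\<^esub> f [x, y]" "f [x, a \<odot>\<^bsub>L\<^esub> y] = \<phi> a \<odot>\<^bsub>M\<^esub> f [x, y]"
    if "a \<in> carrier A" "x \<in> carrier L" "y \<in> carrier L" for a x y
    using that by (auto simp: all_less_2)
  have cocycle: "coboundary L M 2 f [x, y, z] = \<zero>\<^bsub>M\<^esub>"
    if "x \<in> carrier L" "y \<in> carrier L" "z \<in> carrier L" for x y z
    using that unfolding d by (simp add: zero_cochain_def tuples_def)
  show ?thesis
    using cocycle unfolding two_cocycle_def
    by (simp add: coboundary_2 closed skew[symmetric] minus add self twist smult)
qed

lemma two_cocycleD:
  assumes "two_cocycle c"
  shows two_cocycle_closed: "\<lbrakk>x \<in> carrier L; y \<in> carrier L\<rbrakk> \<Longrightarrow> c x y \<in> carrier M"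
    and two_cocycle_add_left: "\<lbrakk>x \<in> carrier L; y \<in> carrier L; z \<in> carrier L\<rbrakk> \<Longrightarrow>
      c (x \<oplus>\<^bsub>L\<^esub> y) z = c x z \<oplus>\<^bsub>M\<^esub> c y z"
    and two_cocycle_add_right: "\<lbrakk>x \<in> carrier L; y \<in> carrier L; z \<in> carrier L\<rbrakk> \<Longrightarrow>
      c x (y \<oplus>\<^bsub>L\<^esub> z) = c x y \<oplus>\<^bsub>M\<^esub> c x z"
    and two_cocycle_self: "x \<in> carrier L \<Longrightarrow> c x x = \<zero>\<^bsub>M\<^esub>"
    and two_cocycle_twist: "\<lbrakk>x \<in> carrier L; y \<in> carrier L\<rbrakk> \<Longrightarrow>
      c (twist L x) (twist L y) = endo M (c x y)"
    and two_cocycle_smult_left: "\<lbrakk>a \<in> carrier A; x \<in> carrier L; y \<in> carrier L\<rbrakk> \<Longrightarrow>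
      c (a \<odot>\<^bsub>L\<^esub> x) y = \<phi> a \<odot>\<^bsub>M\<^esub> c x y"
    and two_cocycle_smult_right: "\<lbrakk>a \<in> carrier A; x \<in> carrier L; y \<in> carrier L\<rbrakk> \<Longrightarrow>
      c x (a \<odot>\<^bsub>L\<^esub> y) = \<phi> a \<odot>\<^bsub>M\<^esub> c x y"
    and two_cocycle_identity: "\<lbrakk>x \<in> carrier L; y \<in> carrier L; z \<in> carrier L\<rbrakk> \<Longrightarrow>
      action M (twist L x) (c y z) \<oplus>\<^bsub>M\<^esub> action M (twist L y) (c z x) \<oplus>\<^bsub>M\<^esub> action M (twist L z) (c x y)
      \<oplus>\<^bsub>M\<^esub> (c (twist L x) (bracket L y z) \<oplus>\<^bsub>M\<^esub> c (twist L y) (bracket L z x)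
      \<oplus>\<^bsub>M\<^esub> c (twist L z) (bracket L x y)) = \<zero>\<^bsub>M\<^esub>"
  using assms unfolding two_cocycle_def by blast+

lemma two_cocycle_skew:
  assumes c: "two_cocycle c" and x: "x \<in> carrier L" and y: "y \<in> carrier L"
  shows "c x y = \<ominus>\<^bsub>M\<^esub> c y x"
proof -
  have "c x y \<oplus>\<^bsub>M\<^esub> c y x = c (x \<oplus>\<^bsub>L\<^esub> y) (x \<oplus>\<^bsub>L\<^esub> y)"
    unfolding two_cocycle_add_left[OF c x y L.a_closed[OF x y]] using x y
    by (simp add: two_cocycleD[OF c])
  also have "\<dots> = \<zero>\<^bsub>M\<^esub>" using x y by (simp add: two_cocycle_self[OF c])
  finally show ?thesis using c x y by (simp add: M.M.minus_equality two_cocycle_def)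
qed

lemma two_cocycle_zero:
  assumes c: "two_cocycle c" and x: "x \<in> carrier L"
  shows "c x \<zero>\<^bsub>L\<^esub> = \<zero>\<^bsub>M\<^esub>" "c \<zero>\<^bsub>L\<^esub> x = \<zero>\<^bsub>M\<^esub>"
proof -
  have "c x (\<zero>\<^bsub>L\<^esub> \<oplus>\<^bsub>L\<^esub> \<zero>\<^bsub>L\<^esub>) = c x \<zero>\<^bsub>L\<^esub> \<oplus>\<^bsub>M\<^esub> c x \<zero>\<^bsub>L\<^esub>" and cl: "c x \<zero>\<^bsub>L\<^esub> \<in> carrier M"
    using c x L.zero_closed unfolding two_cocycle_def by blast+
  then show *: "c x \<zero>\<^bsub>L\<^esub> = \<zero>\<^bsub>M\<^esub>"
    using M.add.l_cancel_one'[OF cl cl] by simp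
  show "c \<zero>\<^bsub>L\<^esub> x = \<zero>\<^bsub>M\<^esub>"
    using two_cocycle_skew[OF c L.zero_closed x] * by simp
qed

lemma two_cocycle_minus:
  assumes c: "two_cocycle c" and x: "x \<in> carrier L" and y: "y \<in> carrier L"
  shows "c x (\<ominus>\<^bsub>L\<^esub> y) = \<ominus>\<^bsub>M\<^esub> c x y"
proof -
  have "c x (\<ominus>\<^bsub>L\<^esub> y) \<oplus>\<^bsub>M\<^esub> c x y = c x (\<ominus>\<^bsub>L\<^esub> y \<oplus>\<^bsub>L\<^esub> y)"
    using c x y by (simp add: two_cocycle_def)
  also have "\<dots> = \<zero>\<^bsub>M\<^esub>" using x y by (simp add: L.M.l_neg two_cocycle_zero[OF c])
  finally show ?thesis using c x y by (simp add: M.M.minus_equality two_cocycle_def)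
qed

text \<open>The inverse translation. Restriction to lists of length 2 over \<open>L\<close> is
  forced, since cochains are undefined on all other lists.\<close>

lemma cocycles_if_two_cocycle:
  assumes c: "two_cocycle c"
  shows "(\<lambda>xs\<in>tuples L 2. c (xs ! 0) (xs ! 1)) \<in> cocycles R A \<phi> L M 2"
proof -
  let ?L = "restrict_scalars A L" and ?M = "restrict_scalars A M"
  note props = two_cocycleD[OF c]
  define f where "f = (\<lambda>xs\<in>tuples L 2. c (xs ! 0) (xs ! 1))"
  have f: "f [x, y] = c x y" if "x \<in> carrier L" "y \<in> carrier L" for x y
    using that by (simp add: f_def tuples_def)
  have t: "tuples ?L n = tuples L n" for n by (simp add: tuples_def)
  have ball: "(\<forall>xs\<in>tuples L 2. P xs) \<longleftrightarrow> (\<forall>x\<in>carrier L. \<forall>y\<in>carrier L. P [x, y])" for P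
    by (auto simp: tuples_2)
  have "f \<in> tuples L 2 \<rightarrow>\<^sub>E carrier M"
    using props by (auto simp: f_def tuples_2)
  then have "f \<in> alternating_maps R ?L ?M 2"
    unfolding alternating_maps_def t
    by (simp add: ball all_less_2 f linear_map_def props Pi_def)
  then have "f \<in> cochains R A \<phi> L M 2"
    by (simp add: cochains_def ball all_less_2 f props)
  \<comment> \<open>The cocycle condition is an equality of functions on all lists; outside the
    triples over \<open>L\<close> both sides are undefined.\<close>
  moreover have "coboundary L M 2 f xs = zero_cochain L M 3 xs" for xs
  proof (cases "xs \<in> tuples L 3")
    case True
    then obtain x y z where xs: "xs = [x, y, z]" "x \<in> carrier L" "y \<in> carrier L" "z \<in> carrier L"
      by (auto simp: tuples_3)
    have "coboundary L M 2 f [x, y, z] = \<zero>\<^bsub>M\<^esub>"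
      using xs(2-4)
      by (subst coboundary_2)
        (simp_all add: f props two_cocycle_skew[OF c, symmetric] two_cocycle_minus[OF c])
    then show ?thesis using True xs(1) by (simp add: zero_cochain_def)
  next
    case False
    then show ?thesis by (simp add: coboundary_def zero_cochain_def)
  qed
  ultimately show ?thesis unfolding f_def by (auto simp: cocycles_def)
qed

text \<open>Degree 2 is the first in which coboundaries come from actual cochains, those of degree
  1. The right-hand side is the form in which equivalences of models produce the same
  condition.\<close>

lemma coboundaries_2_iff:
  "(\<lambda>xs\<in>tuples L 2. f xs \<ominus>\<^bsub>M\<^esub> g xs) \<in> coboundaries R A \<phi> L M 2 \<longleftrightarrow>
    (\<exists>h. one_cochain h \<and> (\<forall>x\<in>carrier L. \<forall>y\<in>carrier L.
       f [x, y] \<ominus>\<^bsub>M\<^esub> g [x, y] = action M x (h y) \<ominus>\<^bsub>M\<^esub> action M y (h x) \<ominus>\<^bsub>M\<^esub> h (bracket L x y)))"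
  (is "?d \<in> _ \<longleftrightarrow> ?rhs")
proof
  assume "?d \<in> coboundaries R A \<phi> L M 2"
  then obtain h where h: "h \<in> cochains R A \<phi> L M 1" and d: "?d = coboundary L M 1 h"
    by (auto simp: coboundaries_def)
  have t: "[x] \<in> tuples L 1" "[x] \<in> tuples (restrict_scalars A L) 1" if "x \<in> carrier L" for x
    using that by (simp_all add: tuples_def)
  have closed: "h [x] \<in> carrier M" if "x \<in> carrier L" for x
    using h t[OF that] by (auto simp: cochains_def alternating_maps_def)
  have "linear_map R (restrict_scalars A L) (restrict_scalars A M) (\<lambda>x. h [x])"
    using h t[OF L.zero_closed] by (force simp: cochains_def alternating_maps_def)
  \<comment> \<open>Here the power of \<phi> has exponent 1 - 1, so the scalar comes out
    unchanged.\<close>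
  moreover have "h [a \<odot>\<^bsub>L\<^esub> x] = a \<odot>\<^bsub>M\<^esub> h [x]" if "a \<in> carrier A" "x \<in> carrier L" for a x
    using h t[OF that(2)] that by (force simp: cochains_def)
  moreover have "h [twist L x] = endo M (h [x])" if "x \<in> carrier L" for x
    using h t[OF that] that by (force simp: cochains_def)
  ultimately have "one_cochain (\<lambda>x. h [x])"
    using closed algebra.one_closed by (auto simp: one_cochain_def linear_map_def)
  moreover have "f [x, y] \<ominus>\<^bsub>M\<^esub> g [x, y] =
      action M x (h [y]) \<ominus>\<^bsub>M\<^esub> action M y (h [x]) \<ominus>\<^bsub>M\<^esub> h [bracket L x y]"
    if "x \<in> carrier L" "y \<in> carrier L" for x y
    using fun_cong[OF d, of "[x, y]"] that by (simp add: coboundary_1[where f = h, OF _ _ closed] tuples_def del: One_nat_def)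
  ultimately show ?rhs by (intro exI[of _ "\<lambda>x. h [x]"]) simp
next
  assume ?rhs
  then obtain h where h: "one_cochain h" and d: "\<And>x y. \<lbrakk>x \<in> carrier L; y \<in> carrier L\<rbrakk> \<Longrightarrow>
      f [x, y] \<ominus>\<^bsub>M\<^esub> g [x, y] = action M x (h y) \<ominus>\<^bsub>M\<^esub> action M y (h x) \<ominus>\<^bsub>M\<^esub> h (bracket L x y)"
    by auto
  let ?h = "\<lambda>xs\<in>tuples L 1. h (xs ! 0)"
  have hx: "?h [x] = h x" if "x \<in> carrier L" for x
    using that by (simp add: tuples_def)
  have t: "tuples (restrict_scalars A L) n = tuples L n" for n by (simp add: tuples_def)
  have ball: "(\<forall>xs\<in>tuples L (Suc 0). P xs) \<longleftrightarrow> (\<forall>x\<in>carrier L. P [x])" for P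
    by (auto simp: tuples_1)
  have "?h \<in> cochains R A \<phi> L M 1"
    using h unfolding cochains_def alternating_maps_def t
    by (auto simp: one_cochain_def linear_map_def ball hx tuples_1 Pi_def)
  moreover have "?d xs = coboundary L M 1 ?h xs" for xs
  proof (cases "xs \<in> tuples L 2")
    case True
    then obtain x y where xs: "xs = [x, y]" "x \<in> carrier L" "y \<in> carrier L"
      by (auto simp: tuples_2)
    have "coboundary L M 1 ?h [x, y] = f [x, y] \<ominus>\<^bsub>M\<^esub> g [x, y]"
      using xs h
      by (subst coboundary_1) (auto simp: hx d one_cochain_def linear_map_def simp del: restrict_apply One_nat_def)
    then show ?thesis using True xs(1) by simp
  next
    case False
    then show ?thesis by (simp add: coboundary_def numeral_2_eq_2)
  qed
  ultimately have "?d = coboundary L M 1 ?h" "?h \<in> cochains R A \<phi> L M 1" by auto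
  then show "?d \<in> coboundaries R A \<phi> L M 2"
    by (simp add: coboundaries_def)
qed

end

section \<open>The extension defined by a cocycle\<close>

locale hLR_model = hLR_module R A \<phi> L M
  for R :: "('r, 'c) ring_scheme" and A :: "('r, 'a, 'd) module_scheme"
    and \<phi> :: "'a \<Rightarrow> 'a" and L :: "('a, 'l) hlr" and M :: "('a, 'l, 'm) hlr_module" +
  fixes j :: "'l \<times> 'm \<Rightarrow> 'e"
  assumes inj: "inj_on j (carrier L \<times> carrier M)"
begin

abbreviation k :: "'e \<Rightarrow> 'l \<times> 'm" where
  "k \<equiv> the_inv_into (carrier L \<times> carrier M) j"

text \<open>The middle term has to live in the type \<open>'e\<close>, so the structure on
  \<open>L\<close> times \<open>M\<close> is carried along \<open>j\<close>, with \<open>k\<close>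
  decoding its elements. The two \<open>undefined\<close> fields are the ring fields that modules
  inherit without using them.\<close>

definition model :: "('l \<Rightarrow> 'l \<Rightarrow> 'm) \<Rightarrow> ('a, 'e) hlr" where
  "model c =
     \<lparr>carrier = j ` (carrier L \<times> carrier M), monoid.mult = undefined, one = undefined,
      zero = j (\<zero>\<^bsub>L\<^esub>, \<zero>\<^bsub>M\<^esub>),
      add = (\<lambda>d e. j (fst (k d) \<oplus>\<^bsub>L\<^esub> fst (k e), snd (k d) \<oplus>\<^bsub>M\<^esub> snd (k e))),
      smult = (\<lambda>a e. j (a \<odot>\<^bsub>L\<^esub> fst (k e), a \<odot>\<^bsub>M\<^esub> snd (k e))),
      bracket = (\<lambda>d e. j (bracket L (fst (k d)) (fst (k e)),
        action M (fst (k d)) (snd (k e)) \<ominus>\<^bsub>M\<^esub> action M (fst (k e)) (snd (k d))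
          \<oplus>\<^bsub>M\<^esub> c (fst (k d)) (fst (k e)))),
      twist = (\<lambda>e. j (twist L (fst (k e)), endo M (snd (k e)))),
      anchor = (\<lambda>e. anchor L (fst (k e)))\<rparr>"

lemma k_j [simp]: "x \<in> carrier L \<Longrightarrow> m \<in> carrier M \<Longrightarrow> k (j (x, m)) = (x, m)"
  by (simp add: the_inv_into_f_f inj)

lemma j_eq_iff:
  "\<lbrakk>x \<in> carrier L; m \<in> carrier M; y \<in> carrier L; n \<in> carrier M\<rbrakk> \<Longrightarrow>
    j (x, m) = j (y, n) \<longleftrightarrow> x = y \<and> m = n"
  using inj by (auto simp: inj_on_def)

lemma carrier_model: "carrier (model c) = (\<lambda>(x, m). j (x, m)) ` (carrier L \<times> carrier M)"
  by (auto simp: model_def)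

lemma ball_model: "(\<forall>e\<in>carrier (model c). P e) \<longleftrightarrow> (\<forall>x\<in>carrier L. \<forall>m\<in>carrier M. P (j (x, m)))"
  by (auto simp: carrier_model)

lemma j_in_model [simp]: "x \<in> carrier L \<Longrightarrow> m \<in> carrier M \<Longrightarrow> j (x, m) \<in> carrier (model c)"
  by (auto simp: carrier_model)

lemma model_simps [simp]:
  "\<zero>\<^bsub>model c\<^esub> = j (\<zero>\<^bsub>L\<^esub>, \<zero>\<^bsub>M\<^esub>)"
  "\<lbrakk>x \<in> carrier L; m \<in> carrier M; y \<in> carrier L; n \<in> carrier M\<rbrakk> \<Longrightarrow>
    j (x, m) \<oplus>\<^bsub>model c\<^esub> j (y, n) = j (x \<oplus>\<^bsub>L\<^esub> y, m \<oplus>\<^bsub>M\<^esub> n)"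
  "\<lbrakk>x \<in> carrier L; m \<in> carrier M\<rbrakk> \<Longrightarrow>
    a \<odot>\<^bsub>model c\<^esub> j (x, m) = j (a \<odot>\<^bsub>L\<^esub> x, a \<odot>\<^bsub>M\<^esub> m)"
  "\<lbrakk>x \<in> carrier L; m \<in> carrier M; y \<in> carrier L; n \<in> carrier M\<rbrakk> \<Longrightarrow>
    bracket (model c) (j (x, m)) (j (y, n)) =
      j (bracket L x y, action M x n \<ominus>\<^bsub>M\<^esub> action M y m \<oplus>\<^bsub>M\<^esub> c x y)"
  "\<lbrakk>x \<in> carrier L; m \<in> carrier M\<rbrakk> \<Longrightarrow> twist (model c) (j (x, m)) = j (twist L x, endo M m)"
  "\<lbrakk>x \<in> carrier L; m \<in> carrier M\<rbrakk> \<Longrightarrow> anchor (model c) (j (x, m)) = anchor L x"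
  by (simp_all add: model_def)

lemma module_model: "module A (model c)"
proof (rule moduleI)
  show "abelian_group (model c)"
  proof (rule abelian_groupI)
    fix e assume "e \<in> carrier (model c)"
    then obtain x m where e: "e = j (x, m)" "x \<in> carrier L" "m \<in> carrier M"
      by (auto simp: carrier_model)
    then show "\<exists>d\<in>carrier (model c). d \<oplus>\<^bsub>model c\<^esub> e = \<zero>\<^bsub>model c\<^esub>"
      by (intro bexI[of _ "j (\<ominus>\<^bsub>L\<^esub> x, \<ominus>\<^bsub>M\<^esub> m)"]) (auto simp: L.M.l_neg M.M.l_neg)
  qed (auto simp: carrier_model L.M.a_ac M.M.a_ac)
qed (auto simp: carrier_model L.smult_l_distr M.smult_l_distr L.smult_r_distr M.smult_r_distr
    L.smult_assoc1 M.smult_assoc1 algebra.is_cring)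

lemma action_diff:
  assumes "x \<in> carrier L" "m \<in> carrier M" "n \<in> carrier M"
  shows "action M x (m \<ominus>\<^bsub>M\<^esub> n) = action M x m \<ominus>\<^bsub>M\<^esub> action M x n"
  using assms by (simp add: a_minus_def action_add_right action_minus_right)

lemma endo_diff:
  assumes "m \<in> carrier M" "n \<in> carrier M"
  shows "endo M (m \<ominus>\<^bsub>M\<^esub> n) = endo M m \<ominus>\<^bsub>M\<^esub> endo M n"
  using assms by (simp add: a_minus_def endo_add endo_minus)

lemma smult_diff: 
  assumes "a \<in> carrier A" "m \<in> carrier M" "n \<in> carrier M"
  shows "a \<odot>\<^bsub>M\<^esub> (m \<ominus>\<^bsub>M\<^esub> n) = a \<odot>\<^bsub>M\<^esub> m \<ominus>\<^bsub>M\<^esub> a \<odot>\<^bsub>M\<^esub> n"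
  using assms by (simp add: a_minus_def M.smult_r_distr M.smult_r_minus)

text \<open>The \<open>L\<close>-component is the Jacobi identity of \<open>L\<close>. In the
  \<open>M\<close>-component the representation law expands each action of a bracket on a twisted
  element into two double actions; all double actions cancel, and what remains is the cocycle
  identity.\<close>

lemma model_jacobi:
  assumes c: "two_cocycle c"
    and x: "x \<in> carrier L" and m: "m \<in> carrier M" and y: "y \<in> carrier L" and n: "n \<in> carrier M"
    and z: "z \<in> carrier L" and p: "p \<in> carrier M"
  defines "E \<equiv> model c" and "d \<equiv> j (x, m)" and "e \<equiv> j (y, n)" and "f \<equiv> j (z, p)"
  shows "bracket E (twist E d) (bracket E e f) \<oplus>\<^bsub>E\<^esub> bracket E (twist E e) (bracket E f d)
    \<oplus>\<^bsub>E\<^esub> bracket E (twist E f) (bracket E d e) = \<zero>\<^bsub>E\<^esub>"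
proof -
  note cl = two_cocycle_closed[OF c]
  show ?thesis
    using x m y n z p M.M.cyclic_cancel[of "action M (twist L x) (action M y p)"
        "action M (twist L x) (action M z n)" "action M (twist L y) (action M z m)"
        "action M (twist L z) (action M y m)" "action M (twist L y) (action M x p)"
        "action M (twist L z) (action M x n)"
        "action M (twist L x) (c y z)" "action M (twist L y) (c z x)" "action M (twist L z) (c x y)"
        "c (twist L x) (bracket L y z)" "c (twist L y) (bracket L z x)" "c (twist L z) (bracket L x y)"]
    by (simp add: E_def d_def e_def f_def cl action_bracket action_add_right action_diff
        jacobi two_cocycle_identity[OF c])
qed

lemma hom_Lie_Rinehart_model:
  assumes c: "two_cocycle c"
  shows "hom_Lie_Rinehart R A \<phi> (model c)"
proof -
  note props = two_cocycleD[OF c]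
  have "faithful_module A (model c)"
    unfolding faithful_module_def
  proof (intro conjI ballI impI)
    fix a assume a: "a \<in> carrier A" and *: "\<forall>e\<in>carrier (model c). a \<odot>\<^bsub>model c\<^esub> e = \<zero>\<^bsub>model c\<^esub>"
    \<comment> \<open>A scalar that annihilates every pair annihilates every first component, so
      faithfulness is inherited from \<open>L\<close>.\<close>
    have "a \<odot>\<^bsub>L\<^esub> x = \<zero>\<^bsub>L\<^esub>" if "x \<in> carrier L" for x
      using * that a by (auto simp: ball_model j_eq_iff)
    then show "a = \<zero>\<^bsub>A\<^esub>" using faithful a by (auto simp: faithful_module_def)
  qed (rule module_model)
  moreover have "bilinear_map R (restrict_scalars A (model c)) (restrict_scalars A (model c))
      (restrict_scalars A (model c)) (bracket (model c))"
    unfolding bilinear_map_def linear_map_def restrict_scalars_simps ball_model Pi_iff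
    by (auto simp: props j_eq_iff bracket_add_left bracket_add_right action_add_left action_add_right
      bracket_scalar_left bracket_scalar_right action_smult_left action_scalar_right
      M.smult_r_distr smult_diff a_minus_def M.M.minus_add M.M.a_ac M.smult_r_minus)
  moreover have "linear_map R (restrict_scalars A (model c)) (restrict_scalars A (model c)) (twist (model c))"
    unfolding linear_map_def restrict_scalars_simps ball_model Pi_iff
    by (auto simp: j_eq_iff twist_add endo_add twist_smult endo_smult)
  moreover have "bracket (model c) e e = \<zero>\<^bsub>model c\<^esub>" if "e \<in> carrier (model c)" for e
    using that by (auto simp: carrier_model props a_minus_def M.M.r_neg)
  \<comment> \<open>The condition c(\<alpha> x, \<alpha> y) = \<beta> (c(x, y)) on cochains is what
    makes the twist multiplicative.\<close>
  moreover have "\<forall>d\<in>carrier (model c). \<forall>e\<in>carrier (model c).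
      twist (model c) (bracket (model c) d e) = bracket (model c) (twist (model c) d) (twist (model c) e)"
    unfolding ball_model by (simp add: props twist_bracket endo_add endo_diff endo_action)
  ultimately have "hom_Lie_algebra R (restrict_scalars A (model c)) (bracket (model c)) (twist (model c))"
    using restrict_scalars_module[OF alg module_model] model_jacobi[OF c]
    unfolding hom_Lie_algebra_def restrict_scalars_simps
    by (auto simp: ball_model)
  \<comment> \<open>The anchor sees only first components, on which the bracket and the twist are
    those of \<open>L\<close>.\<close>
  moreover have "hom_Lie_representation R (restrict_scalars A (model c)) (bracket (model c))
      (twist (model c)) A (anchor (model c)) \<phi>"
    unfolding hom_Lie_representation_def bilinear_map_def restrict_scalars_simps ball_model
    using phi_linear module_RA
    by (auto simp: props anchor_linear anchor_twist anchor_bracket linear_map_def[of R "restrict_scalars A (model c)"]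
      Pi_iff ball_model anchor_add_left anchor_scalar_left)
  \<comment> \<open>In the \<open>M\<close>-component the anchor term comes from {x, a.n} alone;
    {a.y, m} and c(x, a.y) contribute only the factor \<phi>(a).\<close>
  moreover have "\<forall>d\<in>carrier (model c). \<forall>a\<in>carrier A. \<forall>e\<in>carrier (model c).
      bracket (model c) d (a \<odot>\<^bsub>model c\<^esub> e) =
        \<phi> a \<odot>\<^bsub>model c\<^esub> bracket (model c) d e \<oplus>\<^bsub>model c\<^esub> anchor (model c) d a \<odot>\<^bsub>model c\<^esub> twist (model c) e"
    unfolding ball_model
    by (auto simp: props j_eq_iff bracket_smult_right action_smult_left action_smult_right
      M.smult_r_distr smult_diff a_minus_def M.M.minus_add M.M.a_ac M.smult_r_minus)
  ultimately show ?thesis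
    using \<open>faithful_module A (model c)\<close> alg alg_endo anchor_derivation
    unfolding hom_Lie_Rinehart_def ball_model
    by (simp add: props twist_smult endo_smult anchor_smult)
qed

end

section \<open>Morphisms of extensions\<close>

text \<open>On images under \<open>f\<close> the operations of \<open>K\<close> are images of those
  of \<open>E\<close>. Removing \<open>f\<close> again requires the results to lie in
  \<open>E\<close>, hence the closure hypotheses.\<close>

lemma hlr_iso_if_bij_betw:
  assumes E: "module A E" and hom: "hlr_hom A E K f" and bij: "bij_betw f (carrier E) (carrier K)"
    and br: "\<And>x y. x \<in> carrier E \<Longrightarrow> y \<in> carrier E \<Longrightarrow> bracket E x y \<in> carrier E"
    and tw: "\<And>x. x \<in> carrier E \<Longrightarrow> twist E x \<in> carrier E"
  shows "hlr_iso A E K f"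
proof -
  interpret E: module A E by fact
  let ?g = "the_inv_into (carrier E) f"
  have inj: "inj_on f (carrier E)" and im: "carrier K = f ` carrier E"
    using bij by (auto simp: bij_betw_def)
  have gf: "?g (f x) = x" if "x \<in> carrier E" for x
    using that inj by (simp add: the_inv_into_f_f)
  have f: "f (x \<oplus>\<^bsub>E\<^esub> y) = f x \<oplus>\<^bsub>K\<^esub> f y" "f (bracket E x y) = bracket K (f x) (f y)"
    if "x \<in> carrier E" "y \<in> carrier E" for x y
    using hom that by (auto simp: hlr_hom_def linear_map_def)
  have f': "f (a \<odot>\<^bsub>E\<^esub> x) = a \<odot>\<^bsub>K\<^esub> f x" if "a \<in> carrier A" "x \<in> carrier E" for a x
    using hom that by (auto simp: hlr_hom_def linear_map_def)
  have f'': "f (twist E x) = twist K (f x)" if "x \<in> carrier E" for x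
    using hom that by (auto simp: hlr_hom_def linear_map_def)
  have an: "anchor K (f x) a = anchor E x a" if "a \<in> carrier A" "x \<in> carrier E" for a x
    using hom that by (auto simp: hlr_hom_def linear_map_def)
  have "hlr_hom A K E ?g"
    unfolding hlr_hom_def linear_map_def im
    by (auto simp: gf an f[symmetric] f'[symmetric] f''[symmetric] br tw)
  then show ?thesis
    using hom gf unfolding hlr_iso_def im by (intro conjI exI[of _ ?g]) auto
qed

lemma hlr_hom_comp:
  assumes "hlr_hom A E F f" "hlr_hom A F G g"
  shows "hlr_hom A E G (g \<circ> f)"
  using assms unfolding hlr_hom_def linear_map_def by (auto simp: Pi_iff)

lemma equivalent_extensions_refl: "equivalent_extensions A M X X"
proof -
  obtain E i \<sigma> where X: "X = (E, i, \<sigma>)" by (cases X)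
  have "hlr_hom A E E (\<lambda>x. x)" by (simp add: hlr_hom_def linear_map_def)
  then show ?thesis unfolding X equivalent_extensions_def hlr_iso_def by auto
qed

lemma equivalent_extensions_trans:
  assumes "equivalent_extensions A M X Y" "equivalent_extensions A M Y Z"
  shows "equivalent_extensions A M X Z"
proof -
  obtain E i \<sigma> E' i' \<sigma>' E'' i'' \<sigma>''
    where XYZ: "X = (E, i, \<sigma>)" "Y = (E', i', \<sigma>')" "Z = (E'', i'', \<sigma>'')" by (metis prod_cases3)
  from assms obtain \<Phi> \<Psi> where \<Phi>: "hlr_iso A E E' \<Phi>" "\<And>m. m \<in> carrier M \<Longrightarrow> \<Phi> (i m) = i' m"
      "\<And>x. x \<in> carrier E \<Longrightarrow> \<sigma>' (\<Phi> x) = \<sigma> x"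
    and \<Psi>: "hlr_iso A E' E'' \<Psi>" "\<And>m. m \<in> carrier M \<Longrightarrow> \<Psi> (i' m) = i'' m"
      "\<And>x. x \<in> carrier E' \<Longrightarrow> \<sigma>'' (\<Psi> x) = \<sigma>' x"
    unfolding XYZ equivalent_extensions_def by auto
  have closed: "\<Phi> x \<in> carrier E'" if "x \<in> carrier E" for x
    using \<Phi>(1) that by (auto simp: hlr_iso_def hlr_hom_def linear_map_def)
  obtain f where f: "hlr_hom A E' E f" "\<And>x. x \<in> carrier E \<Longrightarrow> f (\<Phi> x) = x" "\<And>y. y \<in> carrier E' \<Longrightarrow> \<Phi> (f y) = y"
    using \<Phi>(1) by (auto simp: hlr_iso_def)
  obtain g where g: "hlr_hom A E'' E' g" "\<And>x. x \<in> carrier E' \<Longrightarrow> g (\<Psi> x) = x" "\<And>y. y \<in> carrier E'' \<Longrightarrow> \<Psi> (g y) = y"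
    using \<Psi>(1) by (auto simp: hlr_iso_def)
  have "g y \<in> carrier E'" if "y \<in> carrier E''" for y
    using g(1) that by (auto simp: hlr_hom_def linear_map_def)
  then have "hlr_iso A E E'' (\<Psi> \<circ> \<Phi>)"
    using hlr_hom_comp[of A E E' \<Phi> E'' \<Psi>] hlr_hom_comp[OF g(1) f(1)] \<Phi>(1) \<Psi>(1) f g closed
    unfolding hlr_iso_def by (intro conjI exI[of _ "f \<circ> g"]) auto
  then show ?thesis
    using \<Phi> \<Psi> closed unfolding XYZ equivalent_extensions_def by (auto intro!: exI[of _ "\<Psi> \<circ> \<Phi>"])
qed

text \<open>The inverse undoes \<Phi> on the carrier only, so \<open>i m\<close> must be known to
  lie there before it can be recovered from \<open>i' m\<close>.\<close>

lemma equivalent_extensions_sym: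
  assumes "equivalent_extensions A M (E, i, \<sigma>) (E', i', \<sigma>')" "\<And>m. m \<in> carrier M \<Longrightarrow> i m \<in> carrier E"
  shows "equivalent_extensions A M (E', i', \<sigma>') (E, i, \<sigma>)"
proof -
  from assms(1) obtain \<Phi> where \<Phi>: "hlr_iso A E E' \<Phi>" "\<And>m. m \<in> carrier M \<Longrightarrow> \<Phi> (i m) = i' m"
      "\<And>x. x \<in> carrier E \<Longrightarrow> \<sigma>' (\<Phi> x) = \<sigma> x"
    unfolding equivalent_extensions_def by auto
  then obtain f where f: "hlr_hom A E' E f" "\<And>x. x \<in> carrier E \<Longrightarrow> f (\<Phi> x) = x" "\<And>y. y \<in> carrier E' \<Longrightarrow> \<Phi> (f y) = y"
    by (auto simp: hlr_iso_def)
  then have "hlr_iso A E' E f" using \<Phi>(1) by (auto simp: hlr_iso_def)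
  moreover have "f (i' m) = i m" if "m \<in> carrier M" for m
    using that f(2)[OF assms(2)[OF that]] \<Phi>(2) by simp
  moreover have "\<sigma> (f y) = \<sigma>' y" if "y \<in> carrier E'" for y
  proof -
    have "f y \<in> carrier E" using f(1) that by (auto simp: hlr_hom_def linear_map_def)
    then show ?thesis using \<Phi>(3)[of "f y"] f(3)[OF that] by simp
  qed
  ultimately show ?thesis unfolding equivalent_extensions_def by auto
qed

text \<open>The short five lemma, by a diagram chase with the identity on both outer terms.\<close>

lemma short_exact_morphism_bij:
  assumes E: "short_exact R A \<phi> K i E \<sigma> L" and E': "short_exact R A \<phi> K i' E' \<sigma>' L"
    and \<Phi>: "hlr_hom A E E' \<Phi>" and \<Phi>i: "\<And>m. m \<in> carrier K \<Longrightarrow> \<Phi> (i m) = i' m"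
    and \<sigma>\<Phi>: "\<And>x. x \<in> carrier E \<Longrightarrow> \<sigma>' (\<Phi> x) = \<sigma> x"
  shows "bij_betw \<Phi> (carrier E) (carrier E')"
proof -
  interpret E: hLR R A \<phi> E using E by unfold_locales (auto simp: short_exact_def)
  interpret E': hLR R A \<phi> E' using E' by unfold_locales (auto simp: short_exact_def)
  interpret L: hLR R A \<phi> L using E by unfold_locales (auto simp: short_exact_def)
  interpret K: hLR R A \<phi> K using E by unfold_locales (auto simp: short_exact_def)
  have lin: "linear_map A E E' \<Phi>" "linear_map A E L \<sigma>" "linear_map A E' L \<sigma>'" "linear_map A K E i" "linear_map A K E' i'"
    using E E' \<Phi> by (auto simp: short_exact_def hlr_hom_def)
  have closed: "x \<in> carrier E \<Longrightarrow> \<Phi> x \<in> carrier E'" "x \<in> carrier E \<Longrightarrow> \<sigma> x \<in> carrier L"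
    "x' \<in> carrier E' \<Longrightarrow> \<sigma>' x' \<in> carrier L" "m \<in> carrier K \<Longrightarrow> i m \<in> carrier E" for x x' m
    using lin by (auto simp: linear_map_def)
  have ker: "\<exists>m\<in>carrier K. x = i m" if "x \<in> carrier E" "\<sigma> x = \<zero>\<^bsub>L\<^esub>" for x
    using E that by (auto simp: short_exact_def)
  have ker': "\<exists>m\<in>carrier K. x = i' m" if "x \<in> carrier E'" "\<sigma>' x = \<zero>\<^bsub>L\<^esub>" for x
    using E' that by (auto simp: short_exact_def)
  have inj': "inj_on i' (carrier K)" and surj: "\<sigma> ` carrier E = carrier L"
    using E E' by (auto simp: short_exact_def)
  have "x = y" if xy: "x \<in> carrier E" "y \<in> carrier E" "\<Phi> x = \<Phi> y" for x y
  proof -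
    \<comment> \<open>The difference is killed by \<Phi>, hence by \<sigma>, so it equals
      \<open>i m\<close> for some \<open>m\<close>; then \<open>i' m\<close> is zero, and
      injectivity of \<open>i'\<close> gives \<open>m = 0\<close>.\<close>
    have 0: "\<Phi> (x \<ominus>\<^bsub>E\<^esub> y) = \<zero>\<^bsub>E'\<^esub>"
      using linear_map_diff[OF E.mod E'.mod lin(1) xy(1,2)] xy closed by (simp add: a_minus_def E'.L.M.r_neg)
    then have "\<sigma> (x \<ominus>\<^bsub>E\<^esub> y) = \<zero>\<^bsub>L\<^esub>"
      using \<sigma>\<Phi>[of "x \<ominus>\<^bsub>E\<^esub> y"] linear_map_zero[OF E'.mod L.mod lin(3)] xy by simp
    then obtain m where m: "m \<in> carrier K" "x \<ominus>\<^bsub>E\<^esub> y = i m" using ker[of "x \<ominus>\<^bsub>E\<^esub> y"] xy by auto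
    then have "i' m = i' \<zero>\<^bsub>K\<^esub>"
      using \<Phi>i 0 linear_map_zero[OF K.mod E'.mod lin(5)] by simp
    then have "m = \<zero>\<^bsub>K\<^esub>" using inj' m by (auto dest: inj_onD)
    then have "x \<ominus>\<^bsub>E\<^esub> y = \<zero>\<^bsub>E\<^esub>" using m linear_map_zero[OF K.mod E.mod lin(4)] by simp
    moreover have "x = (x \<ominus>\<^bsub>E\<^esub> y) \<oplus>\<^bsub>E\<^esub> y"
      using xy by (simp add: a_minus_def E.L.M.a_assoc E.L.M.l_neg)
    ultimately show ?thesis using xy by simp
  qed
  then have "inj_on \<Phi> (carrier E)" by (auto intro: inj_onI)
  moreover have "\<exists>x\<in>carrier E. \<Phi> x = y" if y: "y \<in> carrier E'" for y
  proof -
    \<comment> \<open>A lift through \<sigma> of the image of \<open>y\<close> in \<open>L\<close>.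
      Its value under \<Phi> misses \<open>y\<close> by some \<open>i' m\<close>, and adding
      \<open>i m\<close> to the lift corrects this.\<close>
    obtain x where x: "x \<in> carrier E" "\<sigma> x = \<sigma>' y" using surj closed(3)[OF y] by (metis imageE)
    have "\<sigma>' (y \<ominus>\<^bsub>E'\<^esub> \<Phi> x) = \<zero>\<^bsub>L\<^esub>"
      using linear_map_diff[OF E'.mod L.mod lin(3) y closed(1)[OF x(1)]] x \<sigma>\<Phi> y closed
      by (simp add: a_minus_def L.L.M.r_neg)
    then obtain m where m: "m \<in> carrier K" "y \<ominus>\<^bsub>E'\<^esub> \<Phi> x = i' m" using ker'[of "y \<ominus>\<^bsub>E'\<^esub> \<Phi> x"] y closed(1)[OF x(1)] by auto
    have "\<Phi> (i m \<oplus>\<^bsub>E\<^esub> x) = (y \<ominus>\<^bsub>E'\<^esub> \<Phi> x) \<oplus>\<^bsub>E'\<^esub> \<Phi> x"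
      using lin(1) m x closed \<Phi>i by (simp add: linear_map_def)
    also have "\<dots> = y" using y x closed by (simp add: a_minus_def E'.L.M.a_assoc E'.L.M.l_neg)
    finally show ?thesis using m x closed by (intro bexI[of _ "i m \<oplus>\<^bsub>E\<^esub> x"]) auto
  qed
  ultimately show ?thesis using closed by (auto simp: bij_betw_def)
qed

section \<open>Abelian extensions and their morphisms\<close>

context hLR_module
begin

lemma hom_Lie_Rinehart_trivial: "hom_Lie_Rinehart R A \<phi> (trivial_hlr A M)"
proof -
  let ?T = "trivial_hlr A M"
  have [simp]: "carrier ?T = carrier M" "zero ?T = zero M" "add ?T = add M" "smult ?T = smult M"
    "bracket ?T = (\<lambda>m n. \<zero>\<^bsub>M\<^esub>)" "twist ?T = endo M" "anchor ?T = (\<lambda>m a. \<zero>\<^bsub>A\<^esub>)"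
    by (simp_all add: trivial_hlr_def)
  have "module A ?T"
  proof (rule moduleI)
    show "abelian_group ?T"
      by (rule abelian_groupI) (auto simp: M.M.a_ac intro: bexI[of _ "\<ominus>\<^bsub>M\<^esub> _"] M.M.l_neg)
  qed (auto simp: algebra.is_cring M.smult_l_distr M.smult_r_distr M.smult_assoc1)
  moreover have "\<forall>a\<in>carrier A. (\<forall>m\<in>carrier M. a \<odot>\<^bsub>M\<^esub> m = \<zero>\<^bsub>M\<^esub>) \<longrightarrow> a = \<zero>\<^bsub>A\<^esub>"
    using left_module by (simp add: left_module_def faithful_module_def)
  \<comment> \<open>For the zero anchor, the two representation laws on \<open>A\<close> read 0 =
    \<phi>(0) and 0 = 0 - 0.\<close>
  moreover have "\<phi> \<zero>\<^bsub>A\<^esub> = \<zero>\<^bsub>A\<^esub>"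
    using linear_map_zero[OF module_RA module_RA phi_linear] .
  moreover have "\<zero>\<^bsub>A\<^esub> \<ominus>\<^bsub>A\<^esub> \<zero>\<^bsub>A\<^esub> = \<zero>\<^bsub>A\<^esub>" by (simp add: a_minus_def)
  moreover have "(\<lambda>a. \<zero>\<^bsub>A\<^esub>) \<in> phi_derivations R A \<phi>"
    by (simp add: phi_derivations_def linear_map_def)
  moreover have "bilinear_map R (restrict_scalars A ?T) (restrict_scalars A ?T) (restrict_scalars A ?T) (\<lambda>m n. \<zero>\<^bsub>M\<^esub>)"
    "bilinear_map R (restrict_scalars A ?T) A A (\<lambda>m a. \<zero>\<^bsub>A\<^esub>)"
    "linear_map R (restrict_scalars A ?T) (restrict_scalars A ?T) (endo M)"
    using linear_endo by (simp_all add: bilinear_map_def linear_map_def)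
  ultimately show ?thesis
    using restrict_scalars_module[OF alg \<open>module A ?T\<close>] alg alg_endo phi_linear module_RA
    by (simp add: hom_Lie_Rinehart_def faithful_module_def
      hom_Lie_algebra_def hom_Lie_representation_def endo_smult)
qed

text \<open>By the five lemma the morphism is bijective, and its inverse is automatically a
  morphism. Equivalences can therefore be given by a formula in one direction.\<close>

lemma equivalent_if_morphism:
  assumes E: "abelian_extension R A \<phi> L M (E, i, \<sigma>)" and E': "abelian_extension R A \<phi> L M (E', i', \<sigma>')"
    and \<Phi>: "hlr_hom A E E' \<Phi>" and \<Phi>i: "\<And>m. m \<in> carrier M \<Longrightarrow> \<Phi> (i m) = i' m"
    and \<sigma>\<Phi>: "\<And>x. x \<in> carrier E \<Longrightarrow> \<sigma>' (\<Phi> x) = \<sigma> x"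
  shows "equivalent_extensions A M (E, i, \<sigma>) (E', i', \<sigma>')"
proof -
  have se: "short_exact R A \<phi> (trivial_hlr A M) i E \<sigma> L" "short_exact R A \<phi> (trivial_hlr A M) i' E' \<sigma>' L"
    using E E' by (auto simp: abelian_extension_def)
  interpret E: hLR R A \<phi> E using se(1) by unfold_locales (auto simp: short_exact_def)
  have "bij_betw \<Phi> (carrier E) (carrier E')"
    using short_exact_morphism_bij[OF se \<Phi> _ \<sigma>\<Phi>] \<Phi>i by (simp add: trivial_hlr_def)
  then have "hlr_iso A E E' \<Phi>"
    using hlr_iso_if_bij_betw[OF E.mod \<Phi>] by simp
  then show ?thesis using \<Phi>i \<sigma>\<Phi> by (auto simp: equivalent_extensions_def)
qed

end

section \<open>Classification of split extensions\<close>

context hLR_model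
begin

definition model_extension :: "('l \<Rightarrow> 'l \<Rightarrow> 'm) \<Rightarrow> ('a, 'e) hlr \<times> ('m \<Rightarrow> 'e) \<times> ('e \<Rightarrow> 'l)" where
  "model_extension c = (model c, (\<lambda>m. j (\<zero>\<^bsub>L\<^esub>, m)), (\<lambda>e. fst (k e)))"

lemma model_extension_split:
  assumes c: "two_cocycle c"
  shows "model_extension c \<in> split_abelian_extensions R A \<phi> L M"
proof -
  have hom_i: "hlr_hom A (trivial_hlr A M) (model c) (\<lambda>m. j (\<zero>\<^bsub>L\<^esub>, m))"
    unfolding hlr_hom_def linear_map_def
    by (auto simp: trivial_hlr_def two_cocycle_zero[OF c] a_minus_def M.M.neg_zero)
  have hom_\<sigma>: "hlr_hom A (model c) L (\<lambda>e. fst (k e))"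
    unfolding hlr_hom_def linear_map_def ball_model Pi_iff
    by (auto simp: two_cocycleD[OF c])
  have inj_i: "inj_on (\<lambda>m. j (\<zero>\<^bsub>L\<^esub>, m)) (carrier (trivial_hlr A M))"
    by (rule inj_onI) (simp add: trivial_hlr_def j_eq_iff)
  have surj: "(\<lambda>e. fst (k e)) ` carrier (model c) = carrier L"
    by (auto simp: carrier_model image_image intro!: image_eqI[of _ _ "(_, \<zero>\<^bsub>M\<^esub>)"])
  have exact: "(\<lambda>m. j (\<zero>\<^bsub>L\<^esub>, m)) ` carrier (trivial_hlr A M) = {e \<in> carrier (model c). fst (k e) = \<zero>\<^bsub>L\<^esub>}"
    by (auto simp: trivial_hlr_def carrier_model)
  have "short_exact R A \<phi> (trivial_hlr A M) (\<lambda>m. j (\<zero>\<^bsub>L\<^esub>, m)) (model c) (\<lambda>e. fst (k e)) L"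
    unfolding short_exact_def
    by (intro conjI hom_Lie_Rinehart_trivial hom_Lie_Rinehart_model[OF c] hLR hom_i hom_\<sigma> inj_i surj exact)
  moreover have "\<forall>e\<in>carrier (model c). \<forall>m\<in>carrier M.
      bracket (model c) e (j (\<zero>\<^bsub>L\<^esub>, m)) = j (\<zero>\<^bsub>L\<^esub>, action M (fst (k e)) m)"
    unfolding ball_model by (simp add: two_cocycle_zero[OF c] a_minus_def M.M.neg_zero)
  \<comment> \<open>The section sends x to the pair (x, 0). It commutes with the twists because
    \<beta> fixes 0, and its failure to be multiplicative is exactly \<open>c\<close>.\<close>
  moreover have "A_split A (model c) (\<lambda>e. fst (k e)) L"
    unfolding A_split_def linear_map_def
    by (intro exI[of _ "\<lambda>x. j (x, \<zero>\<^bsub>M\<^esub>)"]) auto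
  ultimately show ?thesis
    by (simp add: split_abelian_extensions_def abelian_extension_def model_extension_def)
qed

lemma model_extension_abelian:
  "two_cocycle c \<Longrightarrow> abelian_extension R A \<phi> L M (model_extension c)"
  using model_extension_split by (auto simp: split_abelian_extensions_def model_extension_def)

text \<open>Compatibility with the inclusions and projections leaves only the second component of
  \<Phi>(x, 0) free. That component is \<open>h\<close>: linearity and compatibility with the twist
  make it a 1-cochain, and compatibility with the bracket is the displayed equation.\<close>

lemma model_equivalent_iff:
  assumes c: "two_cocycle c" and d: "two_cocycle d"
  shows "equivalent_extensions A M (model_extension c) (model_extension d) \<longleftrightarrow>
    (\<exists>h. one_cochain h \<and> (\<forall>x\<in>carrier L. \<forall>y\<in>carrier L.
       c x y \<ominus>\<^bsub>M\<^esub> d x y = action M x (h y) \<ominus>\<^bsub>M\<^esub> action M y (h x) \<ominus>\<^bsub>M\<^esub> h (bracket L x y)))"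
    (is "?lhs \<longleftrightarrow> ?rhs")
proof
  assume ?lhs
  then obtain \<Phi> where hom: "hlr_hom A (model c) (model d) \<Phi>"
    and \<Phi>i: "\<And>m. m \<in> carrier M \<Longrightarrow> \<Phi> (j (\<zero>\<^bsub>L\<^esub>, m)) = j (\<zero>\<^bsub>L\<^esub>, m)"
    and \<sigma>\<Phi>: "\<And>e. e \<in> carrier (model c) \<Longrightarrow> fst (k (\<Phi> e)) = fst (k e)"
    by (auto simp: equivalent_extensions_def model_extension_def hlr_iso_def)
  define h where "h x = snd (k (\<Phi> (j (x, \<zero>\<^bsub>M\<^esub>))))" for x
  have \<Phi>0: "\<Phi> (j (x, \<zero>\<^bsub>M\<^esub>)) = j (x, h x) \<and> h x \<in> carrier M" if "x \<in> carrier L" for x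
  proof -
    have "\<Phi> (j (x, \<zero>\<^bsub>M\<^esub>)) \<in> carrier (model d)"
      using hom that by (auto simp: hlr_hom_def linear_map_def)
    then obtain y m where "\<Phi> (j (x, \<zero>\<^bsub>M\<^esub>)) = j (y, m)" "y \<in> carrier L" "m \<in> carrier M"
      by (auto simp: carrier_model)
    then show ?thesis using \<sigma>\<Phi>[of "j (x, \<zero>\<^bsub>M\<^esub>)"] that by (simp add: h_def)
  qed
  then have hc: "h x \<in> carrier M" if "x \<in> carrier L" for x using that by blast
  have add: "\<Phi> (u \<oplus>\<^bsub>model c\<^esub> v) = \<Phi> u \<oplus>\<^bsub>model d\<^esub> \<Phi> v"
    "\<Phi> (bracket (model c) u v) = bracket (model d) (\<Phi> u) (\<Phi> v)"
    if "u \<in> carrier (model c)" "v \<in> carrier (model c)" for u v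
    using hom that by (auto simp: hlr_hom_def linear_map_def)
  have smult: "\<Phi> (a \<odot>\<^bsub>model c\<^esub> u) = a \<odot>\<^bsub>model d\<^esub> \<Phi> u"
    if "a \<in> carrier A" "u \<in> carrier (model c)" for a u
    using hom that by (auto simp: hlr_hom_def linear_map_def)
  have twist: "\<Phi> (twist (model c) u) = twist (model d) (\<Phi> u)" if "u \<in> carrier (model c)" for u
    using hom that by (auto simp: hlr_hom_def)
  \<comment> \<open>Decompose (x, m) as (x, 0) + (0, m); the second summand lies in the image of
    \<open>M\<close>, which \<Phi> fixes.\<close>
  have \<Phi>: "\<Phi> (j (x, m)) = j (x, h x \<oplus>\<^bsub>M\<^esub> m)" if "x \<in> carrier L" "m \<in> carrier M" for x m
    using add(1)[of "j (x, \<zero>\<^bsub>M\<^esub>)" "j (\<zero>\<^bsub>L\<^esub>, m)"] that by (simp add: \<Phi>0 \<Phi>i hc)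
  have "one_cochain h"
    unfolding one_cochain_def linear_map_def
  proof (intro conjI ballI funcsetI)
    fix x y assume xy: "x \<in> carrier L" "y \<in> carrier L"
    then show "h (x \<oplus>\<^bsub>L\<^esub> y) = h x \<oplus>\<^bsub>M\<^esub> h y"
      using add(1)[of "j (x, \<zero>\<^bsub>M\<^esub>)" "j (y, \<zero>\<^bsub>M\<^esub>)"] by (simp add: \<Phi>0 hc j_eq_iff)
  next
    fix a x assume "a \<in> carrier A" "x \<in> carrier L"
    then show "h (a \<odot>\<^bsub>L\<^esub> x) = a \<odot>\<^bsub>M\<^esub> h x"
      using smult[of a "j (x, \<zero>\<^bsub>M\<^esub>)"] by (simp add: \<Phi>0 hc j_eq_iff)
  next
    fix x assume "x \<in> carrier L"
    then show "h (twist L x) = endo M (h x)"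
      using twist[of "j (x, \<zero>\<^bsub>M\<^esub>)"] by (simp add: \<Phi>0 hc j_eq_iff)
  qed (rule hc)
  moreover have "c x y \<ominus>\<^bsub>M\<^esub> d x y = action M x (h y) \<ominus>\<^bsub>M\<^esub> action M y (h x) \<ominus>\<^bsub>M\<^esub> h (bracket L x y)"
    if xy: "x \<in> carrier L" "y \<in> carrier L" for x y
  proof -
    have cl: "c x y \<in> carrier M" "d x y \<in> carrier M" "h (bracket L x y) \<in> carrier M"
      "action M x (h y) \<ominus>\<^bsub>M\<^esub> action M y (h x) \<in> carrier M"
      using xy by (auto simp: two_cocycle_closed[OF c] two_cocycle_closed[OF d] hc)
    \<comment> \<open>These are the second components of \<Phi> [(x, 0), (y, 0)] and of
      [\<Phi>(x, 0), \<Phi>(y, 0)].\<close>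
    have "h (bracket L x y) \<oplus>\<^bsub>M\<^esub> c x y = (action M x (h y) \<ominus>\<^bsub>M\<^esub> action M y (h x)) \<oplus>\<^bsub>M\<^esub> d x y"
      using add(2)[of "j (x, \<zero>\<^bsub>M\<^esub>)" "j (y, \<zero>\<^bsub>M\<^esub>)"] xy cl by (simp add: \<Phi>0 \<Phi> hc j_eq_iff a_minus_def M.M.neg_zero)
    then show ?thesis using M.M.diff_eq_diff cl by blast
  qed
  ultimately show ?rhs by blast
next
  assume ?rhs
  then obtain h where h: "one_cochain h" and eq: "\<And>x y. \<lbrakk>x \<in> carrier L; y \<in> carrier L\<rbrakk> \<Longrightarrow>
      c x y \<ominus>\<^bsub>M\<^esub> d x y = action M x (h y) \<ominus>\<^bsub>M\<^esub> action M y (h x) \<ominus>\<^bsub>M\<^esub> h (bracket L x y)"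
    by auto
  have hs: "x \<in> carrier L \<Longrightarrow> h x \<in> carrier M" "x \<in> carrier L \<Longrightarrow> y \<in> carrier L \<Longrightarrow> h (x \<oplus>\<^bsub>L\<^esub> y) = h x \<oplus>\<^bsub>M\<^esub> h y"
    "a \<in> carrier A \<Longrightarrow> x \<in> carrier L \<Longrightarrow> h (a \<odot>\<^bsub>L\<^esub> x) = a \<odot>\<^bsub>M\<^esub> h x"
    "x \<in> carrier L \<Longrightarrow> h (twist L x) = endo M (h x)" for a x y
    using h by (auto simp: one_cochain_def linear_map_def)
  have h0: "h \<zero>\<^bsub>L\<^esub> = \<zero>\<^bsub>M\<^esub>"
    using linear_map_zero[OF mod module_M] h by (auto simp: one_cochain_def)
  define \<Phi> where "\<Phi> e = j (fst (k e), h (fst (k e)) \<oplus>\<^bsub>M\<^esub> snd (k e))" for e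
  have \<Phi>: "\<Phi> (j (x, m)) = j (x, h x \<oplus>\<^bsub>M\<^esub> m)" if "x \<in> carrier L" "m \<in> carrier M" for x m
    using that by (simp add: \<Phi>_def)
  note cls = two_cocycle_closed[OF c] two_cocycle_closed[OF d] hs(1)
  have br: "h (bracket L x y) \<oplus>\<^bsub>M\<^esub> (action M x n \<ominus>\<^bsub>M\<^esub> action M y m \<oplus>\<^bsub>M\<^esub> c x y) =
      action M x (h y \<oplus>\<^bsub>M\<^esub> n) \<ominus>\<^bsub>M\<^esub> action M y (h x \<oplus>\<^bsub>M\<^esub> m) \<oplus>\<^bsub>M\<^esub> d x y"
    if xy: "x \<in> carrier L" "y \<in> carrier L" "m \<in> carrier M" "n \<in> carrier M" for x y m n
  proof -
    \<comment> \<open>After substituting d + \<delta> h for c, the last term of \<delta> h cancels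
      against h [x, y]; additivity of the action does the rest.\<close>
    have "c x y = d x y \<oplus>\<^bsub>M\<^esub> (c x y \<ominus>\<^bsub>M\<^esub> d x y)"
      using xy by (simp add: cls a_minus_def M.M.a_lcomm[of "d x y"] M.M.r_neg)
    then have 1: "c x y = d x y \<oplus>\<^bsub>M\<^esub> (action M x (h y) \<ominus>\<^bsub>M\<^esub> action M y (h x) \<ominus>\<^bsub>M\<^esub> h (bracket L x y))"
      using eq[OF xy(1,2)] by simp
    have "h (bracket L x y) \<oplus>\<^bsub>M\<^esub> (\<ominus>\<^bsub>M\<^esub> h (bracket L x y) \<oplus>\<^bsub>M\<^esub> z) = z" if "z \<in> carrier M" for z
      using that xy by (simp add: cls M.M.a_assoc[symmetric] M.M.r_neg)
    then have 2: "h (bracket L x y) \<oplus>\<^bsub>M\<^esub> (p \<oplus>\<^bsub>M\<^esub> (q \<ominus>\<^bsub>M\<^esub> h (bracket L x y))) = p \<oplus>\<^bsub>M\<^esub> q"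
      if "p \<in> carrier M" "q \<in> carrier M" for p q
      using that xy cls by (simp add: a_minus_def M.M.a_ac M.M.a_lcomm[of _ "\<ominus>\<^bsub>M\<^esub> h (bracket L x y)"])
    have "h (bracket L x y) \<oplus>\<^bsub>M\<^esub> (action M x n \<ominus>\<^bsub>M\<^esub> action M y m \<oplus>\<^bsub>M\<^esub> c x y) =
        h (bracket L x y) \<oplus>\<^bsub>M\<^esub> ((action M x n \<ominus>\<^bsub>M\<^esub> action M y m \<oplus>\<^bsub>M\<^esub> d x y) \<oplus>\<^bsub>M\<^esub>
          ((action M x (h y) \<ominus>\<^bsub>M\<^esub> action M y (h x)) \<ominus>\<^bsub>M\<^esub> h (bracket L x y)))"
      by (subst 1) (use xy in \<open>simp add: cls M.M.a_assoc\<close>)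
    also have "\<dots> = action M x n \<ominus>\<^bsub>M\<^esub> action M y m \<oplus>\<^bsub>M\<^esub> d x y \<oplus>\<^bsub>M\<^esub> (action M x (h y) \<ominus>\<^bsub>M\<^esub> action M y (h x))"
      by (rule 2) (use xy in \<open>simp_all add: cls\<close>)
    also have "\<dots> = action M x (h y \<oplus>\<^bsub>M\<^esub> n) \<ominus>\<^bsub>M\<^esub> action M y (h x \<oplus>\<^bsub>M\<^esub> m) \<oplus>\<^bsub>M\<^esub> d x y"
      using xy by (simp add: cls action_add_right a_minus_def M.M.minus_add M.M.a_ac)
    finally show ?thesis .
  qed
  have add4: "h x \<oplus>\<^bsub>M\<^esub> h y \<oplus>\<^bsub>M\<^esub> (m \<oplus>\<^bsub>M\<^esub> n) = h x \<oplus>\<^bsub>M\<^esub> m \<oplus>\<^bsub>M\<^esub> (h y \<oplus>\<^bsub>M\<^esub> n)"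
    if "x \<in> carrier L" "y \<in> carrier L" "m \<in> carrier M" "n \<in> carrier M" for x y m n
    using that by (simp add: cls M.M.a_ac)
  have "hlr_hom A (model c) (model d) \<Phi>"
    unfolding hlr_hom_def linear_map_def ball_model Pi_iff
    by (auto simp: \<Phi> hs j_eq_iff br cls M.smult_r_distr endo_add add4)
  moreover have "fst (k (\<Phi> e)) = fst (k e)" if "e \<in> carrier (model c)" for e
    using that by (auto simp: carrier_model \<Phi> hs)
  ultimately show ?lhs
    using equivalent_if_morphism[OF model_extension_abelian[OF c, unfolded model_extension_def]
        model_extension_abelian[OF d, unfolded model_extension_def], of \<Phi>]
    by (simp add: model_extension_def \<Phi> h0)
qed

text \<open>Each property of \<open>c\<close> is tested under the injective \<open>i\<close>, where
  it becomes a statement about brackets of values of \<tau>. The model maps to the extension, and a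
  morphism in this direction suffices.\<close>

lemma split_extension_equivalent_model:
  assumes "X \<in> split_abelian_extensions R A \<phi> L M"
  shows "\<exists>c. two_cocycle c \<and> equivalent_extensions A M (model_extension c) X"
proof -
  obtain E i \<sigma> where X: "X = (E, i, \<sigma>)" by (cases X)
  have ab: "abelian_extension R A \<phi> L M (E, i, \<sigma>)"
    using assms by (auto simp: X split_abelian_extensions_def)
  then have se: "short_exact R A \<phi> (trivial_hlr A M) i E \<sigma> L"
    and act: "\<And>e m. e \<in> carrier E \<Longrightarrow> m \<in> carrier M \<Longrightarrow> bracket E e (i m) = i (action M (\<sigma> e) m)"
    by (auto simp: abelian_extension_def)
  obtain \<tau> where \<tau>_lin: "linear_map A L E \<tau>" and \<sigma>\<tau>: "\<And>x. x \<in> carrier L \<Longrightarrow> \<sigma> (\<tau> x) = x"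
    and \<tau>_twist: "\<And>x. x \<in> carrier L \<Longrightarrow> twist E (\<tau> x) = \<tau> (twist L x)"
    using assms by (auto simp: X split_abelian_extensions_def A_split_def)
  interpret E: hLR R A \<phi> E using se by unfold_locales (auto simp: short_exact_def)
  have \<tau>: "x \<in> carrier L \<Longrightarrow> \<tau> x \<in> carrier E" "x \<in> carrier L \<Longrightarrow> y \<in> carrier L \<Longrightarrow> \<tau> (x \<oplus>\<^bsub>L\<^esub> y) = \<tau> x \<oplus>\<^bsub>E\<^esub> \<tau> y"
    "a \<in> carrier A \<Longrightarrow> x \<in> carrier L \<Longrightarrow> \<tau> (a \<odot>\<^bsub>L\<^esub> x) = a \<odot>\<^bsub>E\<^esub> \<tau> x" for a x y
    using \<tau>_lin by (auto simp: linear_map_def)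
  have \<tau>0: "\<tau> \<zero>\<^bsub>L\<^esub> = \<zero>\<^bsub>E\<^esub>" and \<tau>_minus: "x \<in> carrier L \<Longrightarrow> \<tau> (\<ominus>\<^bsub>L\<^esub> x) = \<ominus>\<^bsub>E\<^esub> \<tau> x" for x
    using linear_map_zero[OF mod E.mod \<tau>_lin] linear_map_minus[OF mod E.mod \<tau>_lin] by auto
  have i_lin: "linear_map A M E i" and i_twist: "\<And>m. m \<in> carrier M \<Longrightarrow> twist E (i m) = i (endo M m)"
    using se by (auto simp: short_exact_def hlr_hom_def linear_map_def trivial_hlr_def)
  have i: "m \<in> carrier M \<Longrightarrow> i m \<in> carrier E" "m \<in> carrier M \<Longrightarrow> n \<in> carrier M \<Longrightarrow> i (m \<oplus>\<^bsub>M\<^esub> n) = i m \<oplus>\<^bsub>E\<^esub> i n"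
    "a \<in> carrier A \<Longrightarrow> m \<in> carrier M \<Longrightarrow> i (a \<odot>\<^bsub>M\<^esub> m) = a \<odot>\<^bsub>E\<^esub> i m" for a m n
    using i_lin by (auto simp: linear_map_def)
  have i0: "i \<zero>\<^bsub>M\<^esub> = \<zero>\<^bsub>E\<^esub>" and i_minus: "m \<in> carrier M \<Longrightarrow> i (\<ominus>\<^bsub>M\<^esub> m) = \<ominus>\<^bsub>E\<^esub> i m" for m
    using linear_map_zero[OF module_M E.mod i_lin] linear_map_minus[OF module_M E.mod i_lin] by auto
  have i_inj: "m = n" if "i m = i n" "m \<in> carrier M" "n \<in> carrier M" for m n
    using se that by (auto simp: short_exact_def trivial_hlr_def dest: inj_onD)
  have \<sigma>_lin: "linear_map A E L \<sigma>" using se by (simp add: short_exact_def hlr_hom_def)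
  have \<sigma>: "e \<in> carrier E \<Longrightarrow> \<sigma> e \<in> carrier L" "e \<in> carrier E \<Longrightarrow> f \<in> carrier E \<Longrightarrow> \<sigma> (e \<oplus>\<^bsub>E\<^esub> f) = \<sigma> e \<oplus>\<^bsub>L\<^esub> \<sigma> f"
    "e \<in> carrier E \<Longrightarrow> f \<in> carrier E \<Longrightarrow> \<sigma> (bracket E e f) = bracket L (\<sigma> e) (\<sigma> f)"
    "e \<in> carrier E \<Longrightarrow> a \<in> carrier A \<Longrightarrow> anchor E e a = anchor L (\<sigma> e) a" for e f a
    using se by (auto simp: short_exact_def hlr_hom_def linear_map_def)
  have exact: "i ` carrier M = {e \<in> carrier E. \<sigma> e = \<zero>\<^bsub>L\<^esub>}"
    using se by (auto simp: short_exact_def trivial_hlr_def)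
  then have \<sigma>i: "\<sigma> (i m) = \<zero>\<^bsub>L\<^esub>" if "m \<in> carrier M" for m using that by auto
  \<comment> \<open>Since \<sigma> preserves brackets and undoes \<tau>, it kills the defect;
    exactness in the middle then places the defect in the image of \<open>M\<close>.\<close>
  have "\<exists>m\<in>carrier M. bracket E (\<tau> x) (\<tau> y) \<ominus>\<^bsub>E\<^esub> \<tau> (bracket L x y) = i m"
    if "x \<in> carrier L" "y \<in> carrier L" for x y
  proof -
    have "\<sigma> (bracket E (\<tau> x) (\<tau> y) \<ominus>\<^bsub>E\<^esub> \<tau> (bracket L x y)) = \<zero>\<^bsub>L\<^esub>"
      using that linear_map_diff[OF E.mod mod \<sigma>_lin, of "bracket E (\<tau> x) (\<tau> y)" "\<tau> (bracket L x y)"]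
      by (simp add: \<tau> \<sigma> \<sigma>\<tau> a_minus_def L.M.r_neg)
    then have "bracket E (\<tau> x) (\<tau> y) \<ominus>\<^bsub>E\<^esub> \<tau> (bracket L x y) \<in> i ` carrier M"
      unfolding exact using that by (simp add: \<tau>)
    then show ?thesis by auto
  qed
  then obtain c where c_closed: "\<And>x y. \<lbrakk>x \<in> carrier L; y \<in> carrier L\<rbrakk> \<Longrightarrow> c x y \<in> carrier M"
    and ic: "\<And>x y. \<lbrakk>x \<in> carrier L; y \<in> carrier L\<rbrakk> \<Longrightarrow> i (c x y) = bracket E (\<tau> x) (\<tau> y) \<ominus>\<^bsub>E\<^esub> \<tau> (bracket L x y)"
    by metis
  have br: "bracket E (\<tau> x) (\<tau> y) = \<tau> (bracket L x y) \<oplus>\<^bsub>E\<^esub> i (c x y)" if "x \<in> carrier L" "y \<in> carrier L" for x y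
    using that by (simp add: ic a_minus_def E.L.M.a_lcomm[of "\<tau> (bracket L x y)"] E.L.M.r_neg \<tau>)
  have "two_cocycle c"
    unfolding two_cocycle_def
  proof (intro conjI ballI)
    fix x y z assume x: "x \<in> carrier L" and y: "y \<in> carrier L" and z: "z \<in> carrier L"
    note cl = x y z c_closed i \<tau>
    show "c (x \<oplus>\<^bsub>L\<^esub> y) z = c x z \<oplus>\<^bsub>M\<^esub> c y z"
      by (rule i_inj) (simp_all add: cl ic E.bracket_add_left bracket_add_left a_minus_def
          E.L.M.minus_add E.L.M.a_ac)
    show "c x (y \<oplus>\<^bsub>L\<^esub> z) = c x y \<oplus>\<^bsub>M\<^esub> c x z"
      by (rule i_inj) (simp_all add: cl ic E.bracket_add_right bracket_add_right a_minus_def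
          E.L.M.minus_add E.L.M.a_ac)
    \<comment> \<open>The inner bracket is expanded by \<open>br\<close>. The outer one then meets a
      value of \<tau>, where \<open>br\<close> applies again, and an element of the image of
      \<open>M\<close>, on which it is the action.\<close>
    have trm: "bracket E (twist E (\<tau> u)) (bracket E (\<tau> v) (\<tau> w)) = \<tau> (bracket L (twist L u) (bracket L v w))
        \<oplus>\<^bsub>E\<^esub> (i (action M (twist L u) (c v w)) \<oplus>\<^bsub>E\<^esub> i (c (twist L u) (bracket L v w)))"
      if "u \<in> carrier L" "v \<in> carrier L" "w \<in> carrier L" for u v w
      using that by (simp add: br \<tau>_twist E.bracket_add_right cl act \<sigma>\<tau> E.L.M.a_ac)
    have t0: "\<tau> (bracket L (twist L x) (bracket L y z)) \<oplus>\<^bsub>E\<^esub> (\<tau> (bracket L (twist L y) (bracket L z x))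
        \<oplus>\<^bsub>E\<^esub> \<tau> (bracket L (twist L z) (bracket L x y))) = \<zero>\<^bsub>E\<^esub>"
      using arg_cong[OF jacobi[OF x y z], of \<tau>] by (simp add: \<tau>0 \<tau> x y z E.L.M.a_assoc)
    \<comment> \<open>In the Jacobi sum of \<open>E\<close>, the values of \<tau> are collected to
      vanish by the Jacobi identity of \<open>L\<close>; what is left is \<open>i\<close> of the
      cocycle expression.\<close>
    have regroup: "(t1 \<oplus>\<^bsub>E\<^esub> (u1 \<oplus>\<^bsub>E\<^esub> v1)) \<oplus>\<^bsub>E\<^esub> (t2 \<oplus>\<^bsub>E\<^esub> (u2 \<oplus>\<^bsub>E\<^esub> v2)) \<oplus>\<^bsub>E\<^esub> (t3 \<oplus>\<^bsub>E\<^esub> (u3 \<oplus>\<^bsub>E\<^esub> v3)) =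
        (t1 \<oplus>\<^bsub>E\<^esub> (t2 \<oplus>\<^bsub>E\<^esub> t3)) \<oplus>\<^bsub>E\<^esub> (u1 \<oplus>\<^bsub>E\<^esub> u2 \<oplus>\<^bsub>E\<^esub> u3 \<oplus>\<^bsub>E\<^esub> (v1 \<oplus>\<^bsub>E\<^esub> v2 \<oplus>\<^bsub>E\<^esub> v3))"
      if "t1 \<in> carrier E" "t2 \<in> carrier E" "t3 \<in> carrier E" "u1 \<in> carrier E" "u2 \<in> carrier E" "u3 \<in> carrier E"
        "v1 \<in> carrier E" "v2 \<in> carrier E" "v3 \<in> carrier E" for t1 t2 t3 u1 u2 u3 v1 v2 v3
      using that by (simp add: E.L.M.a_ac)
    show "action M (twist L x) (c y z) \<oplus>\<^bsub>M\<^esub> action M (twist L y) (c z x) \<oplus>\<^bsub>M\<^esub> action M (twist L z) (c x y)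
        \<oplus>\<^bsub>M\<^esub> (c (twist L x) (bracket L y z) \<oplus>\<^bsub>M\<^esub> c (twist L y) (bracket L z x)
        \<oplus>\<^bsub>M\<^esub> c (twist L z) (bracket L x y)) = \<zero>\<^bsub>M\<^esub>"
      using E.jacobi[of "\<tau> x" "\<tau> y" "\<tau> z"]
      by (intro i_inj) (simp_all add: trm cl regroup t0 i0)
  next
    fix x assume x: "x \<in> carrier L"
    show "c x x = \<zero>\<^bsub>M\<^esub>"
      by (rule i_inj) (use x in \<open>simp_all add: c_closed ic \<tau> \<tau>0 i0 a_minus_def\<close>)
  next
    fix x y assume x: "x \<in> carrier L" and y: "y \<in> carrier L"
    show "c x y \<in> carrier M" using x y by (rule c_closed)
    have tm: "twist E (e \<ominus>\<^bsub>E\<^esub> f) = twist E e \<ominus>\<^bsub>E\<^esub> twist E f" if "e \<in> carrier E" "f \<in> carrier E" for e f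
    proof -
      have "twist E (e \<ominus>\<^bsub>E\<^esub> f) \<oplus>\<^bsub>E\<^esub> twist E f = twist E e"
        using that by (simp add: E.twist_add[symmetric] a_minus_def E.L.M.a_assoc E.L.M.l_neg)
      then show ?thesis using that by (metis E.L.M.add.inv_solve_right E.L.M.minus_closed E.twist_closed a_minus_def)
    qed
    \<comment> \<open>Under \<open>i\<close> the right-hand side is the twist of the defect of x and
      y; moving the twist past the brackets and past \<tau> gives the defect of the twisted
      elements.\<close>
    show "c (twist L x) (twist L y) = endo M (c x y)"
      by (rule i_inj) (use x y in \<open>simp_all add: c_closed ic \<tau> i_twist[symmetric] tm
          E.twist_bracket \<tau>_twist twist_bracket\<close>)
  next
    fix a x y assume a: "a \<in> carrier A" and x: "x \<in> carrier L" and y: "y \<in> carrier L"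
    \<comment> \<open>Here \<open>q\<close> is the anchor term common to the bracket in
      \<open>E\<close> and to \<tau> of the bracket in \<open>L\<close>. It is subtracted when the
      scalar stands in the first argument and added when it stands in the second.\<close>
    have cancel: "(p \<ominus>\<^bsub>E\<^esub> q) \<ominus>\<^bsub>E\<^esub> (r \<ominus>\<^bsub>E\<^esub> q) = p \<ominus>\<^bsub>E\<^esub> r" "(p \<oplus>\<^bsub>E\<^esub> q) \<ominus>\<^bsub>E\<^esub> (r \<oplus>\<^bsub>E\<^esub> q) = p \<ominus>\<^bsub>E\<^esub> r"
      if "p \<in> carrier E" "q \<in> carrier E" "r \<in> carrier E" for p q r
    proof -
      have "q \<oplus>\<^bsub>E\<^esub> (\<ominus>\<^bsub>E\<^esub> q \<oplus>\<^bsub>E\<^esub> s) = s" "\<ominus>\<^bsub>E\<^esub> q \<oplus>\<^bsub>E\<^esub> (q \<oplus>\<^bsub>E\<^esub> s) = s" if "s \<in> carrier E" for s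
        using that \<open>q \<in> carrier E\<close> by (simp_all add: E.L.M.a_assoc[symmetric] E.L.M.r_neg E.L.M.l_neg)
      then show "(p \<ominus>\<^bsub>E\<^esub> q) \<ominus>\<^bsub>E\<^esub> (r \<ominus>\<^bsub>E\<^esub> q) = p \<ominus>\<^bsub>E\<^esub> r" "(p \<oplus>\<^bsub>E\<^esub> q) \<ominus>\<^bsub>E\<^esub> (r \<oplus>\<^bsub>E\<^esub> q) = p \<ominus>\<^bsub>E\<^esub> r"
        using that by (simp_all add: a_minus_def E.L.M.minus_add E.L.M.a_assoc E.L.M.a_comm[of "\<ominus>\<^bsub>E\<^esub> r"])
    qed
    have sd: "b \<odot>\<^bsub>E\<^esub> (p \<ominus>\<^bsub>E\<^esub> q) = b \<odot>\<^bsub>E\<^esub> p \<ominus>\<^bsub>E\<^esub> b \<odot>\<^bsub>E\<^esub> q"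
      if "b \<in> carrier A" "p \<in> carrier E" "q \<in> carrier E" for b p q
      using that by (simp add: a_minus_def E.L.smult_r_distr E.L.smult_r_minus)
    have tm: "\<tau> (u \<ominus>\<^bsub>L\<^esub> v) = \<tau> u \<ominus>\<^bsub>E\<^esub> \<tau> v" if "u \<in> carrier L" "v \<in> carrier L" for u v
      using that by (rule linear_map_diff[OF mod E.mod \<tau>_lin])
    show "c (a \<odot>\<^bsub>L\<^esub> x) y = \<phi> a \<odot>\<^bsub>M\<^esub> c x y"
      by (rule i_inj) (use a x y in \<open>simp_all add: c_closed ic \<tau> i(3) tm sd E.bracket_smult_left
          bracket_smult_left \<sigma> \<sigma>\<tau> \<tau>_twist cancel\<close>)
    show "c x (a \<odot>\<^bsub>L\<^esub> y) = \<phi> a \<odot>\<^bsub>M\<^esub> c x y"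
      by (rule i_inj) (use a x y in \<open>simp_all add: c_closed ic \<tau> i(3) tm sd E.bracket_smult_right
          bracket_smult_right \<sigma> \<sigma>\<tau> \<tau>_twist cancel\<close>)
  qed
  note c = this
  define \<Psi> where "\<Psi> e = \<tau> (fst (k e)) \<oplus>\<^bsub>E\<^esub> i (snd (k e))" for e
  have \<Psi>: "\<Psi> (j (x, m)) = \<tau> x \<oplus>\<^bsub>E\<^esub> i m" if "x \<in> carrier L" "m \<in> carrier M" for x m
    using that by (simp add: \<Psi>_def)
  have \<sigma>\<Psi>: "\<sigma> (\<Psi> (j (x, m))) = x" if "x \<in> carrier L" "m \<in> carrier M" for x m
    using that by (simp add: \<Psi> \<sigma> \<tau> i \<sigma>\<tau> \<sigma>i)
  have \<Psi>br: "\<tau> (bracket L x y) \<oplus>\<^bsub>E\<^esub> i (action M x n \<ominus>\<^bsub>M\<^esub> action M y m \<oplus>\<^bsub>M\<^esub> c x y) =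
      bracket E (\<tau> x \<oplus>\<^bsub>E\<^esub> i m) (\<tau> y \<oplus>\<^bsub>E\<^esub> i n)"
    if xy: "x \<in> carrier L" "y \<in> carrier L" "m \<in> carrier M" "n \<in> carrier M" for x y m n
  proof -
    \<comment> \<open>The condition on abelian extensions covers only brackets with \<open>M\<close>
      on the right, so this term needs skew-symmetry. Two elements of \<open>M\<close> commute
      because \<sigma> sends the left one to 0, which acts as zero.\<close>
    have "bracket E (i m) (\<tau> y) = \<ominus>\<^bsub>E\<^esub> i (action M y m)"
      using xy E.bracket_skew[of "i m" "\<tau> y"] by (simp add: i \<tau> act \<sigma>\<tau>)
    moreover have "bracket E (i m) (i n) = \<zero>\<^bsub>E\<^esub>"
      using xy by (simp add: act i \<sigma>i i0)
    ultimately show ?thesis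
      using xy by (simp add: E.bracket_add_left E.bracket_add_right br act \<sigma> \<sigma>i \<sigma>\<tau> i \<tau> c_closed a_minus_def
        i_minus E.L.M.a_ac)
  qed
  have "hlr_hom A (model c) E \<Psi>"
    unfolding hlr_hom_def linear_map_def ball_model Pi_iff
  proof (intro conjI ballI)
    fix x m a assume "x \<in> carrier L" "m \<in> carrier M" "a \<in> carrier A"
    then show "anchor E (\<Psi> (j (x, m))) a = anchor (model c) (j (x, m)) a"
      using \<sigma>(4)[of "\<Psi> (j (x, m))" a] \<sigma>\<Psi>[of x m] by (simp add: \<Psi> \<tau> i)
  next
    fix x m y n assume "x \<in> carrier L" "m \<in> carrier M" "y \<in> carrier L" "n \<in> carrier M"
    then show "\<Psi> (bracket (model c) (j (x, m)) (j (y, n))) = bracket E (\<Psi> (j (x, m))) (\<Psi> (j (y, n)))"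
      by (simp add: \<Psi> \<Psi>br c_closed)
  qed (auto simp: \<Psi> \<tau> i c_closed E.L.smult_r_distr E.twist_add \<tau>_twist i_twist E.L.M.a_ac)
  moreover have "\<sigma> (\<Psi> e) = fst (k e)" if "e \<in> carrier (model c)" for e
    using that \<sigma>\<Psi> by (auto simp: carrier_model)
  ultimately have "equivalent_extensions A M (model_extension c) X"
    using equivalent_if_morphism[OF model_extension_abelian[OF c, unfolded model_extension_def] ab, of \<Psi>]
    by (simp add: X model_extension_def \<Psi> \<tau>0 i)
  then show ?thesis using c by blast
qed

end

theorem theorem5p5:
  fixes R :: "('r, 'c) ring_scheme"
    and A :: "('r, 'a, 'd) module_scheme"
    and \<phi> :: "'a \<Rightarrow> 'a"
    and L :: "('a, 'l) hlr"
    and M :: "('a, 'l, 'm) hlr_module"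
    and j :: "'l \<times> 'm \<Rightarrow> 'e"
  assumes "hom_Lie_Rinehart R A \<phi> L"
    and "algebra_automorphism R A \<phi>"
    and "left_module R A \<phi> L M"
    and "inj_on j (carrier L \<times> carrier M)"
  shows "\<exists>F. bij_betw F
    (extension_classes R A \<phi> L M :: (('a, 'e) hlr \<times> ('m \<Rightarrow> 'e) \<times> ('e \<Rightarrow> 'l)) set set)
    (cohomology R A \<phi> L M 2)"
proof -
  interpret hLR_model R A \<phi> L M j
    using assms by unfold_locales
  let ?Ext = "split_abelian_extensions R A \<phi> L M :: (('a, 'e) hlr \<times> ('m \<Rightarrow> 'e) \<times> ('e \<Rightarrow> 'l)) set"
  let ?Z = "cocycles R A \<phi> L M 2"
  let ?X = "\<lambda>f. model_extension (\<lambda>x y. f [x, y])"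
  let ?eq = "equivalent_extensions A M :: ('a, 'e) hlr \<times> ('m \<Rightarrow> 'e) \<times> ('e \<Rightarrow> 'l) \<Rightarrow> _"
  have sym: "?eq Y X" if "?eq X Y" "X \<in> ?Ext" for X Y
  proof -
    obtain E i \<sigma> E' i' \<sigma>' where XY: "X = (E, i, \<sigma>)" "Y = (E', i', \<sigma>')" by (metis prod_cases3)
    have "i m \<in> carrier E" if "m \<in> carrier M" for m
      using \<open>X \<in> ?Ext\<close> that by (auto simp: XY split_abelian_extensions_def abelian_extension_def
          short_exact_def hlr_hom_def linear_map_def trivial_hlr_def)
    then show ?thesis using that equivalent_extensions_sym unfolding XY by blast
  qed
  note trans = equivalent_extensions_trans
  \<comment> \<open>Both sides ask for a 1-cochain \<open>h\<close> with f - g = \<delta> h on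
    pairs.\<close>
  have coh: "?eq (?X f) (?X g) \<longleftrightarrow> (\<lambda>xs\<in>tuples L 2. f xs \<ominus>\<^bsub>M\<^esub> g xs) \<in> coboundaries R A \<phi> L M 2"
    if "f \<in> ?Z" "g \<in> ?Z" for f g
    using that by (simp add: model_equivalent_iff two_cocycle_if_cocycles coboundaries_2_iff)
  show ?thesis
    unfolding extension_classes_def cohomology_def
  \<comment> \<open>Several cocycles may be related to the same \<open>X\<close>, one for each
    splitting and more; that they are cohomologous is part of the last condition on the
    correspondence.\<close>
  proof (rule quotient_bij_betw[where C = "\<lambda>X f. X \<in> ?Ext \<and> f \<in> ?Z \<and> ?eq (?X f) X"])
    show "equiv ?Ext {(X, Y). X \<in> ?Ext \<and> Y \<in> ?Ext \<and> ?eq X Y}"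
      by (intro equivI refl_onI symI transI) (auto intro: equivalent_extensions_refl sym trans)
  next
    fix X assume X: "X \<in> ?Ext"
    then obtain c where c: "two_cocycle c" "?eq (model_extension c) X"
      using split_extension_equivalent_model by blast
    let ?f = "\<lambda>xs\<in>tuples L 2. c (xs ! 0) (xs ! 1)"
    have f: "?f \<in> ?Z" by (rule cocycles_if_two_cocycle[OF c(1)])
    \<comment> \<open>The list version of \<open>c\<close> agrees with \<open>c\<close> only on
      elements of \<open>L\<close>, so the two models need not be equal as records. They are
      equivalent through the zero 1-cochain.\<close>
    have "?eq (?X ?f) (model_extension c)"
    proof -
      have "one_cochain (\<lambda>x. \<zero>\<^bsub>M\<^esub>)" by (simp add: one_cochain_def linear_map_def)
      moreover have "?f [x, y] \<ominus>\<^bsub>M\<^esub> c x y =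
          action M x \<zero>\<^bsub>M\<^esub> \<ominus>\<^bsub>M\<^esub> action M y \<zero>\<^bsub>M\<^esub> \<ominus>\<^bsub>M\<^esub> \<zero>\<^bsub>M\<^esub>" if "x \<in> carrier L" "y \<in> carrier L" for x y
        using that two_cocycle_closed[OF c(1) that] by (simp add: tuples_def a_minus_def M.M.r_neg)
      ultimately show ?thesis
        unfolding model_equivalent_iff[OF two_cocycle_if_cocycles[OF f] c(1)] by blast
    qed
    then have "?eq (?X ?f) X" using c(2) by (rule trans)
    then show "\<exists>f. X \<in> ?Ext \<and> f \<in> ?Z \<and> ?eq (?X f) X" using X f by blast
  next
    fix f assume "f \<in> ?Z"
    then show "\<exists>X. X \<in> ?Ext \<and> f \<in> ?Z \<and> ?eq (?X f) X"
      using model_extension_split[OF two_cocycle_if_cocycles] equivalent_extensions_refl by blast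
  next
    fix X Y f g assume X: "X \<in> ?Ext \<and> f \<in> ?Z \<and> ?eq (?X f) X" and Y: "Y \<in> ?Ext \<and> g \<in> ?Z \<and> ?eq (?X g) Y"
    then have ext: "?X f \<in> ?Ext" "?X g \<in> ?Ext"
      using model_extension_split two_cocycle_if_cocycles by blast+
    \<comment> \<open>Both extensions are joined to their models by equivalences; \<open>ext\<close>
      supplies the membership required for symmetry.\<close>
    have "?eq X Y \<longleftrightarrow> ?eq (?X f) (?X g)"
      using X Y ext by (meson sym trans)
    then show "(X, Y) \<in> {(X, Y). X \<in> ?Ext \<and> Y \<in> ?Ext \<and> ?eq X Y} \<longleftrightarrow>
        (f, g) \<in> {(f, g). f \<in> ?Z \<and> g \<in> ?Z \<and> (\<lambda>xs\<in>tuples L 2. f xs \<ominus>\<^bsub>M\<^esub> g xs) \<in> coboundaries R A \<phi> L M 2}"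
      using X Y coh by simp
  qed auto
qed

end
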